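(* Let $\tau,\lambda_1,\lambda_2\in\mathbb{R}$ satisfy $$\tau>1,\qquad \lambda_1,\lambda_2<0,\qquad 1+\tau(1+\lambda_i)>0\ (i=1,2),\qquad 1+\tau(\lambda_1+\lambda_2)<0,$$ and let $q\in\mathbb{C}$ belong to the strip $$\max\Big\{\tfrac12\bigl(1+\tau(1+\lambda_1+\lambda_2)\bigr),\ 1+\tau(1+\lambda_1+\lambda_2)\Big\}<\Re(q)<\min\Big\{\tau,\ 1+\tau(1+\lambda_1),\ 1+\tau(1+\lambda_2)\Big\}.\qquad(\ast)$$ Define $$\mathfrak{M}(q\,|\,\tau,\lambda_1,\lambda_2)=\Bigl(\frac{2\pi\,\tau^{1/\tau}}{\Gamma(1-1/\tau)}\Bigr)^q\,\frac{\Gamma_2(1-q+\tau(1+\lambda_1)|\tau)}{\Gamma_2(1+\tau(1+\lambda_1)|\tau)}\,\frac{\Gamma_2(1-q+\tau(1+\lambda_2)|\tau)}{\Gamma_2(1+\tau(1+\lambda_2)|\tau)}\,\frac{\Gamma_2(-q+\tau|\tau)}{\Gamma_2(\tau|\tau)}\,\frac{\Gamma_2(2-q+\tau(2+\lambda_1+\lambda_2)|\tau)}{\Gamma_2(2-2q+\tau(2+\lambda_1+\lambda_2)|\tau)}$$ and $$\mathfrak{CM}(q\,|\,\tau,\lambda_1,\lambda_2)=\frac{\mathfrak{M}(q\,|\,\tau,\lambda_1,\lambda_2)^2}{\Gamma(1+q)\,\bigl(4\sin(\pi/\tau)\bigr)^q}\,\frac{S_2(1-q+\tau(1+\lambda_1)|\tau)}{S_2(1+\tau(1+\lambda_1)|\tau)}\,\frac{S_2(1-q+\tau(1+\lambda_2)|\tau)}{S_2(1+\tau(1+\lambda_2)|\tau)}\,\frac{S_2(\tau-q|\tau)}{S_2(\tau|\tau)}\,\frac{S_2(2-q+\tau(2+\lambda_1+\lambda_2)|\tau)}{S_2(2-2q+\tau(2+\lambda_1+\lambda_2)|\tau)}.$$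 Then: (1) If $q=n\in\mathbb{N}$ satisfies $(\ast)$, then $$\mathfrak{CM}(n\,|\,\tau,\lambda_1,\lambda_2)=\frac{1}{n!}\Bigl[\prod_{k=0}^{n-1}\frac{\Gamma(1-\frac{k+1}{\tau})\,\Gamma(1+\lambda_1-\frac{k}{\tau})\,\Gamma(1+\lambda_2-\frac{k}{\tau})}{\Gamma(1-\frac1\tau)\,\Gamma(2+\lambda_1+\lambda_2-\frac{n+k-1}{\tau})}\Bigr]^2\prod_{k=0}^{n-1}\frac{\sin\pi(\frac{k+1}{\tau})\,\sin\pi(1+\lambda_1-\frac{k}{\tau})\,\sin\pi(1+\lambda_2-\frac{k}{\tau})}{\sin(\frac{\pi}{\tau})\,\sin\pi(2+\lambda_1+\lambda_2-\frac{n+k-1}{\tau})}.$$ (2) For all $q$ satisfying $(\ast)$, $$\begin{aligned}\mathfrak{CM}(q\,|\,\tau,\lambda_1,\lambda_2)=&\Bigl(\frac{\Gamma(1/\tau)\,\pi\,\tau^{1/\tau}}{\Gamma(1-1/\tau)}\Bigr)^q\,\Gamma\bigl(1-\tfrac q\tau\bigr)\,\frac{\Gamma_2(1-q+\tau(1+\lambda_1)|\tau)}{\Gamma_2(1+\tau(1+\lambda_1)|\tau)}\,\frac{\Gamma_2(1-q+\tau(1+\lambda_2)|\tau)}{\Gamma_2(1+\tau(1+\lambda_2)|\tau)}\\&\times\frac{\Gamma_2(1-q+\tau|\tau)}{\Gamma_2(1+\tau|\tau)}\,\frac{\Gamma_2(2-q+\tau(2+\lambda_1+\lambda_2)|\t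au)}{\Gamma_2(2-2q+\tau(2+\lambda_1+\lambda_2)|\tau)}\,\frac{\Gamma_2(q+1+\tau|\tau)}{\Gamma_2(1+\tau|\tau)}\\&\times\frac{\Gamma_2(q-\tau\lambda_1|\tau)}{\Gamma_2(-\tau\lambda_1|\tau)}\,\frac{\Gamma_2(q-\tau\lambda_2|\tau)}{\Gamma_2(-\tau\lambda_2|\tau)}\,\frac{\Gamma_2(q-1-\tau(1+\lambda_1+\lambda_2)|\tau)}{\Gamma_2(2q-1-\tau(1+\lambda_1+\lambda_2)|\tau)}.\end{aligned}$$
   Context: $\Gamma$ is Euler's gamma function. For $\tau>0$, $\Gamma_2(w|\tau)$ denotes the Barnes double gamma function with parameters $(1,\tau)$: for $\Re(w)>0$, $$\Gamma_2(w|\tau)=\exp\Bigl(\partial_s\zeta_2(s,w)\big|_{s=0}\Bigr),$$ where $\zeta_2(s,w)$ is the analytic continuation in $s$ of $\sum_{k_1,k_2=0}^\infty (w+k_1+k_2\tau)^{-s}$ ($\Re(s)>2$). It extends to a meromorphic function of $w\in\mathbb{C}$ without zeros and with poles exactly at $w=-(k_1+k_2\tau)$, $k_1,k_2=0,1,2,\dots$. It satisfies $$\frac{\Gamma_2(w|\tau)}{\Gamma_2(w+1|\tau)}=\frac{\tau^{w/\tau-1/2}}{\sqrt{2\pi}}\,\Gamma\bigl(\tfrac{w}{\tau}\bigr),\qquad \frac{\Gamma_2(w|\tau)}{\Gamma_2(w+\tau|\tau)}=\frac{1}{\sqrt{2\pi}}\,\Gamma(w).$$ The double sine function with parameters $(1,\tau)$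 is the meromorphic function $$S_2(w|\tau)=\frac{\Gamma_2(1+\tau-w|\tau)}{\Gamma_2(w|\tau)}.$$ Powers $x^q$ with $x>0$ are $e^{q\log x}$ with real $\log x$. In the formula defining $\mathfrak{CM}$, points $q$ of the strip where $\Gamma(1+q)$ has a pole (e.g. $q=-1$) are removable singularities, and the value there is understood by continuity. (The right-hand side in part (1) is the known evaluation of the complex Selberg, or Dotsenko–Fateev, integral $\int_{(\mathbb{R}^2)^n}\prod_{i}|\vec r_i|^{2\lambda_1}|\vec u-\vec r_i|^{2\lambda_2}\prod_{i<j}|\vec r_i-\vec r_j|^{-4/\tau}\,d\vec r_1\cdots d\vec r_n$, with $\vec u$ a unit vector; the claim concerns only the explicit product.) *)

theory Defs
  imports "HOL-Complex_Analysis.Complex_Analysis"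
begin

(* The powers are principal branches; they are used for Re w > 0 and \<tau> > 0 only, where the
   base has positive real part. *)
definition barnes_zeta2_series :: "real \<Rightarrow> complex \<Rightarrow> complex \<Rightarrow> complex" where
  "barnes_zeta2_series \<tau> w s =
     (\<Sum>\<^sub>\<infinity>(k1, k2) \<in> (UNIV :: (nat \<times> nat) set).
        (w + of_nat k1 + of_nat k2 * of_real \<tau>) powr (- s))"

(* Analytic continuation in s: the meromorphic function on the whole plane that agrees with the
   series on Re s > 2.  "Nicely" meromorphic fixes the values at the poles to be 0 and excludes
   spurious values at removable singularities, which makes the continuation unique as a total
   function. *)
definition barnes_zeta2 :: "real \<Rightarrow> complex \<Rightarrow> complex \<Rightarrow> complex" where
  "barnes_zeta2 \<tau> w =
     (THE f. f nicely_meromorphic_on UNIV \<and> (\<forall>s. Re s > 2 \<longrightarrow> f s = barnes_zeta2_series \<tau> w s))"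

(* The first argument is the parameter: Gamma2 \<tau> w is \<Gamma>_2(w | \<tau>).  The value at a pole is 0. *)
definition Gamma2 :: "real \<Rightarrow> complex \<Rightarrow> complex" where
  "Gamma2 \<tau> =
     (THE g. g nicely_meromorphic_on UNIV \<and>
             (\<forall>w. Re w > 0 \<longrightarrow> g w = exp (deriv (barnes_zeta2 \<tau> w) 0)))"

(* Since the poles of numerator and denominator are disjoint and \<Gamma>_2 has no zeros, division by the
   value 0 at a pole of the denominator yields the correct value 0. *)
definition S2 :: "real \<Rightarrow> complex \<Rightarrow> complex" where
  "S2 \<tau> w = Gamma2 \<tau> (1 + of_real \<tau> - w) / Gamma2 \<tau> w"

definition admissible_strip :: "real \<Rightarrow> real \<Rightarrow> real \<Rightarrow> complex set" where
  "admissible_strip \<tau> l1 l2 =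
     {q. max ((1 + \<tau> * (1 + l1 + l2)) / 2) (1 + \<tau> * (1 + l1 + l2)) < Re q \<and>
         Re q < min \<tau> (min (1 + \<tau> * (1 + l1)) (1 + \<tau> * (1 + l2)))}"

definition MM :: "real \<Rightarrow> real \<Rightarrow> real \<Rightarrow> complex \<Rightarrow> complex" where
  "MM \<tau> l1 l2 q =
     of_real (2 * pi * \<tau> powr (1 / \<tau>) / Gamma (1 - 1 / \<tau>)) powr q
     * (Gamma2 \<tau> (1 - q + of_real (\<tau> * (1 + l1))) / Gamma2 \<tau> (1 + of_real (\<tau> * (1 + l1))))
     * (Gamma2 \<tau> (1 - q + of_real (\<tau> * (1 + l2))) / Gamma2 \<tau> (1 + of_real (\<tau> * (1 + l2))))
     * (Gamma2 \<tau> (- q + of_real \<tau>) / Gamma2 \<tau> (of_real \<tau>))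
     * (Gamma2 \<tau> (2 - q + of_real (\<tau> * (2 + l1 + l2)))
        / Gamma2 \<tau> (2 - 2 * q + of_real (\<tau> * (2 + l1 + l2))))"

definition CM_formula :: "real \<Rightarrow> real \<Rightarrow> real \<Rightarrow> complex \<Rightarrow> complex" where
  "CM_formula \<tau> l1 l2 q =
     (MM \<tau> l1 l2 q)\<^sup>2 / (Gamma (1 + q) * of_real (4 * sin (pi / \<tau>)) powr q)
     * (S2 \<tau> (1 - q + of_real (\<tau> * (1 + l1))) / S2 \<tau> (1 + of_real (\<tau> * (1 + l1))))
     * (S2 \<tau> (1 - q + of_real (\<tau> * (1 + l2))) / S2 \<tau> (1 + of_real (\<tau> * (1 + l2))))
     * (S2 \<tau> (of_real \<tau> - q) / S2 \<tau> (of_real \<tau>))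
     * (S2 \<tau> (2 - q + of_real (\<tau> * (2 + l1 + l2)))
        / S2 \<tau> (2 - 2 * q + of_real (\<tau> * (2 + l1 + l2))))"

(* The poles of \<Gamma>(1 + q), where the formula has removable singularities, are filled in by
   continuity. *)
definition CM :: "real \<Rightarrow> real \<Rightarrow> real \<Rightarrow> complex \<Rightarrow> complex" where
  "CM \<tau> l1 l2 q =
     (if 1 + q \<in> \<int>\<^sub>\<le>\<^sub>0 then Lim (at q) (CM_formula \<tau> l1 l2) else CM_formula \<tau> l1 l2 q)"

end

theory Submission
  imports Defs "HOL-Real_Asymp.Real_Asymp"
begin

text \<open>
  Everything reduces to three properties of $\Gamma_2(\cdot|\tau)$ on $\Re w > 0$: it is
  holomorphic, it has no zeros there, and it satisfies the two difference equations for the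
  shifts by $1$ and by $\tau$.  Given these, part (2) is bookkeeping: inserting
  $S_2(w) = \Gamma_2(1+\tau-w)/\Gamma_2(w)$ cancels one of the two copies of each
  $\Gamma_2$-quotient in $\mathfrak{M}^2$, the quotients at $\tau - q$ and $1 + q$ are moved by one
  shift each, which absorbs $\Gamma(1+q)$ and produces $\Gamma(1 - q/\tau)$, and the powers are
  collected with $\Gamma(1/\tau)\Gamma(1-1/\tau) = \pi/\sin(\pi/\tau)$.  Only $1 + q$ may lie outside the
  right half-plane, but it never gets further than one shift by $\tau$; the isolated points where
  $\Gamma(1+q)$ has a pole follow by continuity.  For part (1) the shift by
  $1$ is applied $n$ times to every quotient; it turns quotients of $\Gamma_2$ into products of
  $\Gamma$ and, by the reflection formula, quotients of $S_2$ into products of sines.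

  The properties of $\Gamma_2$ are derived from the definition by zeta regularisation.  For
  $\Re s > 2$ the double series equals $1/\Gamma(s)$ times the Mellin integral
  $\int_0^\infty t^{s-1} e^{-wt} \kappa(t)\,dt$ with
  $\kappa(t) = 1/((1-e^{-t})(1-e^{-\tau t}))$ (\<open>barnes_zeta2_series_eq_mellin\<close>).  The kernel has an
  expansion $\sum_n b_n t^{n-2}$ at $0$.  Subtracting its first $N$ terms, whose Mellin integrals
  are the explicit expressions $b_n \Gamma(s+n-2) w^{2-s-n}$, leaves an integral that converges
  for $\Re s > 2 - N$.  This continues the series to the whole plane, and the case $N = 3$ gives a
  formula for the derivative at $s = 0$ in which the holomorphic dependence on $w$ is visible
  (\<open>zeta_deriv_0\<close>, \<open>log_gamma_holomorphic\<close>).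

  The difference equations come from the kernel as well: multiplying $\kappa$ by $1 - e^{-t}$ or
  $1 - e^{-\tau t}$ leaves the kernel $1/(1-e^{-at})$ of a single zeta function
  (\<open>log_gamma_shift\<close>).  For the latter the same formula for the derivative at $0$ is Binet's formula: up to a
  remainder that vanishes at infinity it is the logarithm of Stirling's approximation.  Together
  with the functional equation of $\Gamma$ this identifies the single gamma function
  (\<open>exp_log_gamma_single\<close>).
\<close>

section \<open>Complex-analytic preliminaries\<close>

lemma Re_pos_not_nonpos_Ints: "Re z > 0 \<Longrightarrow> z \<notin> \<int>\<^sub>\<le>\<^sub>0"
  by (auto elim!: nonpos_Ints_cases)

lemma holomorphic_eq_right_halfplane:
  assumes "f holomorphic_on {w. Re w > 0}" "g holomorphic_on {w. Re w > 0}"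
    and "\<And>x::real. x > 0 \<Longrightarrow> f (of_real x) = g (of_real x)" and "Re w > 0"
  shows "f w = g w"
proof -
  have "f w - g w = 0"
  proof (rule analytic_continuation[of "\<lambda>w. f w - g w" "{w. Re w > 0}" "of_real ` {0<..}" 1])
    show "open {w. Re w > 0}" by (rule open_halfspace_Re_gt)
    show "connected {w. Re w > 0}" by (simp add: convex_connected convex_halfspace_Re_gt)
    have "(1::real) islimpt {0<..}" by (rule interior_limit_point) (simp add: interior_open)
    then have "complex_of_real 1 islimpt of_real ` {0<..}"
      by (rule islimpt_isCont_image) (auto simp: eventually_at_filter intro!: always_eventually)
    then show "(1::complex) islimpt of_real ` {0<..}" by simp
  qed (use assms in \<open>auto intro: holomorphic_intros\<close>)
  then show ?thesis by simp
qed

text \<open>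
  Dominated convergence for the difference quotients: by Cauchy's inequality the local bound
  $g$ on $f$ also bounds the derivative on half the radius, so $2g/r$ is a Lipschitz constant that
  is integrable in the parameter.
\<close>

lemma holomorphic_on_parameter_integral:
  fixes f :: "complex \<Rightarrow> 'a \<Rightarrow> complex"
  assumes "open U"
    and meas: "\<And>z. z \<in> U \<Longrightarrow> f z \<in> borel_measurable M"
    and hol: "\<And>t. t \<in> space M \<Longrightarrow> (\<lambda>z. f z t) holomorphic_on U"
    and dom: "\<And>z0. z0 \<in> U \<Longrightarrow> \<exists>r>0. \<exists>g. cball z0 r \<subseteq> U \<and> integrable M g \<and>
                (\<forall>z\<in>cball z0 r. \<forall>t\<in>space M. norm (f z t) \<le> g t)"
  shows "(\<lambda>z. \<integral>t. f z t \<partial>M) holomorphic_on U"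
proof (rule holomorphic_onI)
  fix z0 assume z0: "z0 \<in> U"
  obtain r g where r: "r > 0" "cball z0 r \<subseteq> U" and g: "integrable M g"
    and fg: "\<And>z t. z \<in> cball z0 r \<Longrightarrow> t \<in> space M \<Longrightarrow> norm (f z t) \<le> g t"
    using dom[OF z0] by blast
  define D where "D t = deriv (\<lambda>z. f z t) z0" for t
  have int: "integrable M (f z)" if "z \<in> cball z0 r" for z
    by (rule Bochner_Integration.integrable_bound[OF g]) (use that r meas fg in \<open>force+\<close>)
  have D: "((\<lambda>z. f z t) has_field_derivative deriv (\<lambda>z. f z t) z) (at z)" if "t \<in> space M" "z \<in> U" for t z
    using hol[OF that(1)] that(2) \<open>open U\<close> holomorphic_derivI by blast
  have Lip: "norm (f z t - f z0 t) \<le> g t / (r / 2) * norm (z - z0)"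
    if t: "t \<in> space M" and z: "z \<in> ball z0 (r / 2)" for t z
  proof (rule field_differentiable_bound[where S = "ball z0 (r / 2)" and f' = "deriv (\<lambda>z. f z t)"])
    fix y assume y: "y \<in> ball z0 (r / 2)"
    have sub: "cball y (r / 2) \<subseteq> cball z0 r"
    proof
      fix x assume "x \<in> cball y (r / 2)"
      then show "x \<in> cball z0 r" using y dist_triangle[of z0 x y] by auto
    qed
    have "y \<in> U" using sub r by (metis centre_in_cball half_gt_zero less_imp_le subsetD)
    then show "((\<lambda>z. f z t) has_field_derivative deriv (\<lambda>z. f z t) y) (at y within ball z0 (r / 2))"
      using D[OF t] has_field_derivative_at_within by blast
    have "norm ((deriv ^^ 1) (\<lambda>z. f z t) y) \<le> fact 1 * g t / (r / 2) ^ 1"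
    proof (rule Cauchy_inequality)
      show "(\<lambda>z. f z t) holomorphic_on ball y (r / 2)"
        by (rule holomorphic_on_subset[OF hol[OF t]]) (use sub r ball_subset_cball in blast)
      show "continuous_on (cball y (r / 2)) (\<lambda>z. f z t)"
        by (rule holomorphic_on_imp_continuous_on, rule holomorphic_on_subset[OF hol[OF t]])
           (use sub r in blast)
      show "norm (f x t) \<le> g t" if "norm (y - x) = r / 2" for x
        by (rule fg[OF _ t]) (use sub that in \<open>auto simp: dist_norm\<close>)
    qed (use r in auto)
    then show "norm (deriv (\<lambda>z. f z t) y) \<le> g t / (r / 2)" by simp
  qed (use z r in auto)
  have "((\<lambda>z. \<integral>t. f z t \<partial>M) has_field_derivative (\<integral>t. D t \<partial>M)) (at z0)"
  proof -
    have "((\<lambda>z. ((\<integral>t. f z t \<partial>M) - (\<integral>t. f z0 t \<partial>M)) / (z - z0)) \<longlongrightarrow> (\<integral>t. D t \<partial>M)) (at z0 within ball z0 (r / 2))"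
      unfolding tendsto_at_iff_sequentially comp_def
    proof (intro allI impI)
      fix X :: "nat \<Rightarrow> complex" assume X: "\<forall>i. X i \<in> ball z0 (r / 2) - {z0}" and lim: "X \<longlonglongrightarrow> z0"
      have Xr: "X i \<in> cball z0 r" for i using X r by (auto simp: less_imp_le dist_commute)
        (smt (verit) X field_sum_of_halves mem_ball Diff_iff)
      let ?q = "\<lambda>i t. (f (X i) t - f z0 t) / (X i - z0)"
      have qD: "(\<lambda>i. ?q i t) \<longlonglongrightarrow> D t" if t: "t \<in> space M" for t
      proof -
        have "((\<lambda>z. (f z t - f z0 t) / (z - z0)) \<longlongrightarrow> D t) (at z0)"
          using D[OF t z0] by (simp add: has_field_derivative_iff D_def)
        moreover have "filterlim X (at z0) sequentially"
          using X lim by (auto simp: filterlim_at)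
        ultimately show ?thesis by (rule filterlim_compose)
      qed
      have qm: "?q i \<in> borel_measurable M" for i
        using meas[of "X i"] meas[of z0] Xr[of i] r z0 by (intro borel_measurable_divide borel_measurable_diff) auto
      have "(\<lambda>i. \<integral>t. ?q i t \<partial>M) \<longlonglongrightarrow> (\<integral>t. D t \<partial>M)"
      proof (rule integral_dominated_convergence[where w = "\<lambda>t. g t / (r / 2)"])
        show "D \<in> borel_measurable M"
          by (rule borel_measurable_LIMSEQ_metric[OF qm qD])
        show "integrable M (\<lambda>t. g t / (r / 2))" using g by simp
        show "AE t in M. norm (?q i t) \<le> g t / (r / 2)" for i
        proof (rule AE_I2)
          fix t assume t: "t \<in> space M"
          have "X i \<in> ball z0 (r / 2)" "X i \<noteq> z0" using X by auto
          then show "norm (?q i t) \<le> g t / (r / 2)"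
            using Lip[OF t, of "X i"] by (simp add: norm_divide divide_le_eq del: times_divide_eq_left)
        qed
      qed (use qm qD in auto)
      moreover have "(\<integral>t. ?q i t \<partial>M) = ((\<integral>t. f (X i) t \<partial>M) - (\<integral>t. f z0 t \<partial>M)) / (X i - z0)" for i
        using int[OF Xr[of i]] int[of z0] r by simp
      ultimately show "(\<lambda>i. ((\<integral>t. f (X i) t \<partial>M) - (\<integral>t. f z0 t \<partial>M)) / (X i - z0)) \<longlonglongrightarrow> (\<integral>t. D t \<partial>M)"
        by (simp only:)
    qed
    then show ?thesis
      unfolding has_field_derivative_iff using r by (simp add: at_within_open[of z0 "ball z0 (r / 2)"])
  qed
  then show "(\<lambda>z. \<integral>t. f z t \<partial>M) field_differentiable at z0 within U"
    using field_differentiable_at_within field_differentiable_def by blast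
qed

lemma meromorphic_Gamma: "Gamma meromorphic_on (A :: complex set)"
proof -
  have "(\<lambda>z. inverse (rGamma z)) meromorphic_on A"
    by (intro meromorphic_on_inverse analytic_on_imp_meromorphic_on analytic_rGamma)
  then show ?thesis by (simp add: rGamma_inverse_Gamma)
qed

text \<open>
  The definitions of the continued zeta and gamma functions are definite descriptions; this
  is their uniqueness part.  By the identity theorem the difference vanishes on a punctured
  neighbourhood of every point, and niceness determines the value at the point itself.
\<close>

lemma nicely_meromorphic_unique:
  assumes f: "f nicely_meromorphic_on UNIV" and g: "g nicely_meromorphic_on UNIV"
    and S: "open S" "S \<noteq> {}" "\<And>z. z \<in> S \<Longrightarrow> f z = g z"
  shows "f = g"
proof
  fix z :: complex
  let ?h = "\<lambda>z. f z - g z"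
  have mero: "?h meromorphic_on UNIV"
    using f g by (intro meromorphic_intros) (auto simp: nicely_meromorphic_on_def)
  have iso: "isolated_singularity_at ?h u" for u
    using mero by (auto simp: meromorphic_on_altdef)
  have ev: "\<forall>\<^sub>F v in at u. remove_sings ?h v = ?h v" for u
    by (rule eventually_remove_sings_eq_at[OF iso])
  obtain z0 where z0: "z0 \<in> S" using S(2) by blast
  have "\<forall>\<^sub>F v in at z0. v \<in> S" by (rule eventually_at_in_open'[OF S(1) z0])
  with ev[of z0] have "\<forall>\<^sub>F v in at z0. remove_sings ?h v = 0"
    by eventually_elim (use S(3) in auto)
  then have "\<exists>\<^sub>F v in at z0. remove_sings ?h v = 0"
    by (intro eventually_frequently) auto
  then have "remove_sings ?h v = 0" for v
    by (rule frequently_eq_meromorphic_imp_constant[OF _ remove_sings_nicely_meromorphic[OF mero]]) auto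
  with ev[of z] have ev_eq: "\<forall>\<^sub>F v in at z. f v = g v" by simp
  then have pole: "is_pole f z \<longleftrightarrow> is_pole g z" by (intro is_pole_cong) auto
  show "f z = g z"
  proof (cases "is_pole f z")
    case True
    then show ?thesis using f g pole
      by (metis UNIV_I nicely_meromorphic_on_def not_tendsto_and_filterlim_at_infinity is_pole_def trivial_limit_at)
  next
    case False
    then have "f \<midarrow>z\<rightarrow> f z" "g \<midarrow>z\<rightarrow> g z" using f g pole by (auto simp: nicely_meromorphic_on_def)
    moreover have "f \<midarrow>z\<rightarrow> g z" using ev_eq calculation(2) by (simp add: tendsto_cong)
    ultimately show ?thesis using LIM_unique by blast
  qed
qed

section \<open>The Mellin transform with an exponential weight\<close>

definition mellin :: "(real \<Rightarrow> complex) \<Rightarrow> complex \<Rightarrow> complex \<Rightarrow> complex" where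
  "mellin f s w = (\<integral>t. of_real t powr (s - 1) * exp (- w * of_real t) * f t \<partial>lebesgue_on {0<..})"

text \<open>
  The growth condition is imposed on all of $(0,\infty)$ with one exponent, so that it controls the
  Mellin integrand near $0$, where it matters, and at infinity, where the exponential weight wins.
\<close>

definition power_bounded :: "real \<Rightarrow> (real \<Rightarrow> complex) \<Rightarrow> bool" where
  "power_bounded a f \<longleftrightarrow> f \<in> borel_measurable (lebesgue_on {0<..}) \<and>
     (\<exists>C. \<forall>t>0. norm (f t) \<le> C * t powr a)"

lemma integrable_powr_exp:
  fixes x u :: real
  assumes "x > -1" "u > 0"
  shows "integrable (lebesgue_on {0<..}) (\<lambda>t. t powr x * exp (- u * t))"
proof -
  have "(\<lambda>t. complex_of_real t powr (of_real (x + 1) - 1) / of_real (exp (u * t))) absolutely_integrable_on {0<..}"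
    using absolutely_integrable_Gamma_integral[of "of_real (x + 1)" u] assms by simp
  then have "integrable (lebesgue_on {0<..}) (\<lambda>t. complex_of_real t powr (of_real (x + 1) - 1) / of_real (exp (u * t)))"
    by (simp add: absolutely_integrable_imp_integrable)
  from integrable_norm[OF this]
  have "integrable (lebesgue_on {0<..}) (\<lambda>t. norm (complex_of_real t powr (of_real (x + 1) - 1) / of_real (exp (u * t))))" .
  moreover have "integrable (lebesgue_on {0<..}) (\<lambda>t. norm (complex_of_real t powr (of_real (x + 1) - 1) / of_real (exp (u * t))))
      \<longleftrightarrow> ?thesis"
    by (intro Bochner_Integration.integrable_cong)
       (auto simp: norm_divide norm_powr_real_powr exp_minus field_simps)
  ultimately show ?thesis by blast
qed

lemma norm_mellin_weight:
  fixes s w :: complex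
  assumes "t > 0"
  shows "norm (complex_of_real t powr (s - 1) * exp (- w * of_real t)) = t powr (Re s - 1) * exp (- Re w * t)"
  using assms by (simp add: norm_mult norm_powr_real_powr)

lemma mellin_integrand_measurable:
  fixes s w :: complex
  assumes "f \<in> borel_measurable (lebesgue_on {0<..})"
  shows "(\<lambda>t. of_real t powr (s - 1) * exp (- w * of_real t) * f t) \<in> borel_measurable (lebesgue_on {0<..})"
proof -
  have "(\<lambda>t. complex_of_real t powr (s - 1) * exp (- w * of_real t)) \<in> borel_measurable (lebesgue_on {0<..})"
    by (intro continuous_imp_measurable_on_sets_lebesgue continuous_intros) (auto simp: complex_nonpos_Reals_iff)
  then show ?thesis using assms by (rule borel_measurable_times)
qed

text \<open>
  A bound that is uniform for $s$ in a vertical strip: $t^{\Re s - 1}$ is dominated by the larger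
  one of the two boundary powers, hence by their sum.
\<close>

lemma mellin_integrand_bound:
  fixes s w :: complex and f :: "real \<Rightarrow> complex"
  assumes C: "norm (f t) \<le> C * t powr a" and t: "t > 0"
    and s: "\<alpha> \<le> Re s" "Re s \<le> \<beta>" and w: "u \<le> Re w"
  shows "norm (of_real t powr (s - 1) * exp (- w * of_real t) * f t)
     \<le> \<bar>C\<bar> * (t powr (\<alpha> + a - 1) * exp (- u * t) + t powr (\<beta> + a - 1) * exp (- u * t))"
proof -
  have 1: "t powr (Re s - 1) \<le> t powr (\<alpha> - 1) + t powr (\<beta> - 1)"
  proof (cases "t \<le> 1")
    case True
    then have "t powr (Re s - 1) \<le> t powr (\<alpha> - 1)" using t s by (intro powr_mono') auto
    then show ?thesis by (smt (verit) powr_ge_zero)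
  next
    case False
    then have "t powr (Re s - 1) \<le> t powr (\<beta> - 1)" using t s by (intro powr_mono) auto
    then show ?thesis by (smt (verit) powr_ge_zero)
  qed
  have "norm (of_real t powr (s - 1) * exp (- w * of_real t) * f t)
      = t powr (Re s - 1) * exp (- Re w * t) * norm (f t)"
    using norm_mellin_weight[OF t, of s w] by (simp only: norm_mult)
  also have "\<dots> \<le> (t powr (\<alpha> - 1) + t powr (\<beta> - 1)) * exp (- u * t) * (\<bar>C\<bar> * t powr a)"
  proof (intro mult_mono 1)
    show "norm (f t) \<le> \<bar>C\<bar> * t powr a"
      using C by (smt (verit) mult_right_mono powr_ge_zero)
  qed (use t w in auto)
  also have "\<dots> = \<bar>C\<bar> * (t powr (\<alpha> + a - 1) * exp (- u * t) + t powr (\<beta> + a - 1) * exp (- u * t))"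
    using t by (simp add: algebra_simps flip: powr_add)
  finally show ?thesis .
qed

lemma mellin_integrable:
  assumes f: "power_bounded a f" and s: "Re s + a > 0" and w: "Re w > 0"
  shows "integrable (lebesgue_on {0<..}) (\<lambda>t. of_real t powr (s - 1) * exp (- w * of_real t) * f t)"
proof -
  from f obtain C where fm: "f \<in> borel_measurable (lebesgue_on {0<..})"
    and C: "\<And>t. t > 0 \<Longrightarrow> norm (f t) \<le> C * t powr a"
    unfolding power_bounded_def by blast
  show ?thesis
  proof (rule Bochner_Integration.integrable_bound[OF _ mellin_integrand_measurable[OF fm]])
    show "integrable (lebesgue_on {0<..}) (\<lambda>t. \<bar>C\<bar> * (t powr (Re s + a - 1) * exp (- Re w * t) + t powr (Re s + a - 1) * exp (- Re w * t)))"
      using integrable_powr_exp[of "Re s + a - 1" "Re w"] s w by (simp add: mult.commute)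
    show "AE t in lebesgue_on {0<..}. norm (of_real t powr (s - 1) * exp (- w * of_real t) * f t)
       \<le> norm (\<bar>C\<bar> * (t powr (Re s + a - 1) * exp (- Re w * t) + t powr (Re s + a - 1) * exp (- Re w * t)))"
    proof (rule AE_I2)
      fix t :: real assume "t \<in> space (lebesgue_on {0<..})"
      then have t: "t > 0" by simp
      show "norm (of_real t powr (s - 1) * exp (- w * of_real t) * f t)
       \<le> norm (\<bar>C\<bar> * (t powr (Re s + a - 1) * exp (- Re w * t) + t powr (Re s + a - 1) * exp (- Re w * t)))"
        using mellin_integrand_bound[where f = f and t = t and C = C and a = a and \<alpha> = "Re s" and \<beta> = "Re s" and s = s and w = w and u = "Re w"] C[OF t] t
        by simp
    qed
  qed
qed

lemma mellin_holomorphic_s: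
  assumes f: "power_bounded a f" and w: "Re w > 0"
  shows "(\<lambda>s. mellin f s w) holomorphic_on {s. Re s > - a}"
  unfolding mellin_def
proof (rule holomorphic_on_parameter_integral)
  from f obtain C where fm: "f \<in> borel_measurable (lebesgue_on {0<..})"
    and C: "\<And>t. t > 0 \<Longrightarrow> norm (f t) \<le> C * t powr a"
    unfolding power_bounded_def by blast
  show "open {s. Re s > - a}" by (rule open_halfspace_Re_gt)
  show "(\<lambda>t. of_real t powr (s - 1) * exp (- w * of_real t) * f t) \<in> borel_measurable (lebesgue_on {0<..})" for s
    by (rule mellin_integrand_measurable[OF fm])
  show "(\<lambda>s. of_real t powr (s - 1) * exp (- w * of_real t) * f t) holomorphic_on {s. Re s > - a}"
    if "t \<in> space (lebesgue_on {0<..})" for t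
    using that by (intro holomorphic_intros) auto
  fix s0 assume s0: "s0 \<in> {s. Re s > - a}"
  define r where "r = (Re s0 + a) / 2"
  have r: "r > 0" using s0 by (simp add: r_def)
  let ?g = "\<lambda>t. \<bar>C\<bar> * (t powr (Re s0 - r + a - 1) * exp (- Re w * t) + t powr (Re s0 + r + a - 1) * exp (- Re w * t))"
  have Re: "\<bar>Re s - Re s0\<bar> \<le> r" if "s \<in> cball s0 r" for s
    using that abs_Re_le_cmod[of "s - s0"] by (simp add: dist_norm norm_minus_commute)
  have "cball s0 r \<subseteq> {s. Re s > - a}"
  proof
    fix s assume "s \<in> cball s0 r"
    then show "s \<in> {s. Re s > - a}" using Re[of s] s0 r by (auto simp: r_def field_simps abs_if split: if_splits)
  qed
  moreover have "integrable (lebesgue_on {0<..}) ?g"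
  proof (intro integrable_mult_right Bochner_Integration.integrable_add integrable_powr_exp w)
    show "Re s0 - r + a - 1 > - 1" "Re s0 + r + a - 1 > - 1"
      using s0 r by (auto simp: r_def field_simps)
  qed
  moreover have "norm (of_real t powr (s - 1) * exp (- w * of_real t) * f t) \<le> ?g t"
    if "s \<in> cball s0 r" "t \<in> space (lebesgue_on {0<..})" for s t
    using mellin_integrand_bound[where f = f and t = t and C = C and a = a and \<alpha> = "Re s0 - r" and s = s and \<beta> = "Re s0 + r" and u = "Re w" and w = w]
      C[of t] Re[OF that(1)] that(2) by (auto simp: abs_le_iff)
  ultimately show "\<exists>r>0. \<exists>g. cball s0 r \<subseteq> {s. Re s > - a} \<and> integrable (lebesgue_on {0<..}) g \<and>
     (\<forall>s\<in>cball s0 r. \<forall>t\<in>space (lebesgue_on {0<..}). norm (of_real t powr (s - 1) * exp (- w * of_real t) * f t) \<le> g t)"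
    using r by blast
qed

lemma mellin_holomorphic_w:
  assumes f: "power_bounded a f" and s: "Re s + a > 0"
  shows "(\<lambda>w. mellin f s w) holomorphic_on {w. Re w > 0}"
  unfolding mellin_def
proof (rule holomorphic_on_parameter_integral)
  from f obtain C where fm: "f \<in> borel_measurable (lebesgue_on {0<..})"
    and C: "\<And>t. t > 0 \<Longrightarrow> norm (f t) \<le> C * t powr a"
    unfolding power_bounded_def by blast
  show "open {w. Re w > 0}" by (rule open_halfspace_Re_gt)
  show "(\<lambda>t. of_real t powr (s - 1) * exp (- w * of_real t) * f t) \<in> borel_measurable (lebesgue_on {0<..})" for w
    by (rule mellin_integrand_measurable[OF fm])
  show "(\<lambda>w. of_real t powr (s - 1) * exp (- w * of_real t) * f t) holomorphic_on {w. Re w > 0}" for t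
    by (intro holomorphic_intros)
  fix w0 :: complex assume w0: "w0 \<in> {w. Re w > 0}"
  define r where "r = Re w0 / 2"
  have r: "r > 0" using w0 by (simp add: r_def)
  let ?g = "\<lambda>t. \<bar>C\<bar> * (t powr (Re s + a - 1) * exp (- r * t) + t powr (Re s + a - 1) * exp (- r * t))"
  have Re: "r \<le> Re w" if "w \<in> cball w0 r" for w
    using that abs_Re_le_cmod[of "w - w0"] by (auto simp: dist_norm norm_minus_commute r_def)
  have "cball w0 r \<subseteq> {w. Re w > 0}"
    using Re r by force
  moreover have "integrable (lebesgue_on {0<..}) ?g"
    using integrable_powr_exp[of "Re s + a - 1" r] s r by (simp add: mult.commute)
  moreover have "norm (of_real t powr (s - 1) * exp (- w * of_real t) * f t) \<le> ?g t"
    if "w \<in> cball w0 r" "t \<in> space (lebesgue_on {0<..})" for w t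
    using mellin_integrand_bound[where f = f and t = t and C = C and a = a and \<alpha> = "Re s" and s = s and \<beta> = "Re s" and u = r and w = w]
      C[of t] Re[OF that(1)] that(2) by (auto simp: abs_le_iff)
  ultimately show "\<exists>r>0. \<exists>g. cball w0 r \<subseteq> {w. Re w > 0} \<and> integrable (lebesgue_on {0<..}) g \<and>
     (\<forall>w\<in>cball w0 r. \<forall>t\<in>space (lebesgue_on {0<..}). norm (of_real t powr (s - 1) * exp (- w * of_real t) * f t) \<le> g t)"
    using r by blast
qed

lemma power_bounded_1: "power_bounded 0 (\<lambda>t. 1)"
  unfolding power_bounded_def by (auto intro!: exI[of _ 1])

text \<open>
  The substitution $t \mapsto ut$ reduces the claim to Euler's integral.  For complex weights the
  substitution is not available; there the formula follows by analytic continuation in $w$.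
\<close>

lemma mellin_one_real:
  assumes s: "Re s > 0" and u: "u > 0"
  shows "mellin (\<lambda>_. 1) s (of_real u) = Gamma s * of_real u powr (- s)"
proof -
  let ?h = "\<lambda>w t. complex_of_real t powr (s - 1) * exp (- w * of_real t)"
  have int1: "integrable (lebesgue_on {0<..}) (?h 1)"
    using mellin_integrable[OF power_bounded_1, of s 1] s by simp
  have "(?h 1 has_integral mellin (\<lambda>_. 1) s 1) {0<..}"
    using has_integral_integral_lebesgue_on[OF int1] by (simp add: mellin_def)
  moreover have "(?h 1 has_integral Gamma s) {0<..}"
    using Gamma_integral_complex'[OF s]
    by (rule has_integral_eq[rotated]) (simp add: exp_minus field_simps exp_of_real)
  ultimately have G: "mellin (\<lambda>_. 1) s 1 = Gamma s" by (rule has_integral_unique)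
  have "mellin (\<lambda>_. 1) s 1 = (\<integral>t. indicator {0<..} t *\<^sub>R ?h 1 t \<partial>lebesgue)"
    unfolding mellin_def by (subst integral_restrict_space) auto
  also have "\<dots> = \<bar>u\<bar> *\<^sub>R (\<integral>t. indicator {0<..} (0 + u * t) *\<^sub>R ?h 1 (0 + u * t) \<partial>lebesgue)"
    by (rule lebesgue_integral_real_affine) (use u in auto)
  also have "(\<lambda>t. indicator {0<..} (0 + u * t) *\<^sub>R ?h 1 (0 + u * t)) =
             (\<lambda>t. indicator {0<..} t *\<^sub>R (of_real u powr (s - 1) * ?h (of_real u) t))"
  proof
    fix t
    show "indicator {0<..} (0 + u * t) *\<^sub>R ?h 1 (0 + u * t) =
             indicator {0<..} t *\<^sub>R (of_real u powr (s - 1) * ?h (of_real u) t)"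
    proof (cases "t > 0")
      case True
      then have "complex_of_real (u * t) powr (s - 1) = of_real u powr (s - 1) * of_real t powr (s - 1)"
        using u by (subst of_real_mult, subst powr_times_real) auto
      then show ?thesis using True u by (simp add: mult_ac)
    next
      case False
      then have "\<not> u * t > 0" using u by (simp add: zero_less_mult_iff)
      then show ?thesis using False by simp
    qed
  qed
  also have "(\<integral>t. indicator {0<..} t *\<^sub>R (of_real u powr (s - 1) * ?h (of_real u) t) \<partial>lebesgue)
           = (\<integral>t. of_real u powr (s - 1) * ?h (of_real u) t \<partial>lebesgue_on {0<..})"
    by (subst integral_restrict_space) auto
  also have "\<dots> = of_real u powr (s - 1) * mellin (\<lambda>_. 1) s (of_real u)"
    unfolding mellin_def by simp
  finally have "Gamma s = of_real u * of_real u powr (s - 1) * mellin (\<lambda>_. 1) s (of_real u)"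
    using u G by (simp add: scaleR_conv_of_real)
  also have "of_real u * of_real u powr (s - 1) = (of_real u powr s :: complex)"
    using u by (simp add: powr_diff)
  finally show ?thesis using u by (simp add: powr_minus field_simps)
qed

lemma mellin_one:
  assumes s: "Re s > 0" and w: "Re w > 0"
  shows "mellin (\<lambda>_. 1) s w = Gamma s * w powr (- s)"
proof (rule holomorphic_eq_right_halfplane[OF _ _ _ w])
  show "(\<lambda>w. mellin (\<lambda>_. 1) s w) holomorphic_on {w. Re w > 0}"
    using mellin_holomorphic_w[OF power_bounded_1, of s] s by simp
  show "(\<lambda>w. Gamma s * w powr (- s)) holomorphic_on {w. Re w > 0}"
    by (intro holomorphic_intros) (auto simp: complex_nonpos_Reals_iff)
qed (use mellin_one_real[OF s] in auto)

lemma mellin_powr: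
  assumes "Re (s + z) > 0" and "Re w > 0"
  shows "mellin (\<lambda>t. of_real t powr z) s w = Gamma (s + z) * w powr (- (s + z))"
proof -
  have "mellin (\<lambda>t. of_real t powr z) s w = mellin (\<lambda>_. 1) (s + z) w"
    unfolding mellin_def
    by (intro Bochner_Integration.integral_cong) (auto simp: powr_add powr_diff)
  then show ?thesis using mellin_one[OF assms] by simp
qed

definition has_mellin :: "(real \<Rightarrow> complex) \<Rightarrow> complex \<Rightarrow> complex \<Rightarrow> complex \<Rightarrow> bool" where
  "has_mellin f s w I \<longleftrightarrow>
     has_bochner_integral (lebesgue_on {0<..}) (\<lambda>t. of_real t powr (s - 1) * exp (- w * of_real t) * f t) I"

lemma has_mellin_imp_eq: "has_mellin f s w I \<Longrightarrow> mellin f s w = I"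
  unfolding has_mellin_def mellin_def by (rule has_bochner_integral_integral_eq)

lemma has_mellin_cong:
  assumes "\<And>t. t > 0 \<Longrightarrow> f t = g t"
  shows "has_mellin f s w I \<longleftrightarrow> has_mellin g s w I"
  unfolding has_mellin_def using assms by (intro has_bochner_integral_cong) auto

lemma has_mellin_add:
  assumes "has_mellin f s w I" "has_mellin g s w J"
  shows "has_mellin (\<lambda>t. f t + g t) s w (I + J)"
  using has_bochner_integral_add[OF assms[unfolded has_mellin_def]]
  by (simp add: has_mellin_def algebra_simps)

lemma has_mellin_diff:
  assumes "has_mellin f s w I" "has_mellin g s w J"
  shows "has_mellin (\<lambda>t. f t - g t) s w (I - J)"
  using has_bochner_integral_diff[OF assms[unfolded has_mellin_def]]
  by (simp add: has_mellin_def algebra_simps)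

lemma has_mellin_cmult:
  assumes "has_mellin f s w I"
  shows "has_mellin (\<lambda>t. c * f t) s w (c * I)"
proof -
  have "has_bochner_integral (lebesgue_on {0<..})
          (\<lambda>t. c * (of_real t powr (s - 1) * exp (- w * of_real t) * f t)) (c * I)"
    by (rule has_bochner_integral_mult_right) (use assms in \<open>auto simp: has_mellin_def\<close>)
  then show ?thesis by (simp add: has_mellin_def mult_ac)
qed

lemma has_mellin_zero: "has_mellin (\<lambda>_. 0) s w 0"
  using has_bochner_integral_zero by (simp add: has_mellin_def)

lemma has_mellin_sum:
  assumes "\<And>i. i \<in> A \<Longrightarrow> has_mellin (f i) s w (I i)"
  shows "has_mellin (\<lambda>t. \<Sum>i\<in>A. f i t) s w (\<Sum>i\<in>A. I i)"
  using assms
  by (induction A rule: infinite_finite_induct) (auto intro!: has_mellin_add has_mellin_zero)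

lemma has_mellin_exp_mult:
  "has_mellin f s (w + a) I \<longleftrightarrow> has_mellin (\<lambda>t. exp (- a * of_real t) * f t) s w I"
  by (simp add: has_mellin_def exp_add exp_diff exp_minus field_simps)

lemma has_mellin_power_bounded:
  assumes "power_bounded a f" "Re s + a > 0" "Re w > 0"
  shows "has_mellin f s w (mellin f s w)"
  using mellin_integrable[OF assms] unfolding has_mellin_def mellin_def
  by (rule has_bochner_integral_integrable)

lemma power_bounded_complex_powr: "power_bounded (Re z) (\<lambda>t. of_real t powr z)"
  unfolding power_bounded_def
proof
  show "(\<lambda>t. complex_of_real t powr z) \<in> borel_measurable (lebesgue_on {0<..})"
    by (intro continuous_imp_measurable_on_sets_lebesgue continuous_intros) (auto simp: complex_nonpos_Reals_iff)
  show "\<exists>C. \<forall>t>0. norm (complex_of_real t powr z) \<le> C * t powr Re z"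
    by (rule exI[of _ 1]) (auto simp: norm_powr_real_powr)
qed

lemma has_mellin_powr:
  assumes "Re (s + z) > 0" and "Re w > 0"
  shows "has_mellin (\<lambda>t. of_real t powr z) s w (Gamma (s + z) * w powr (- (s + z)))"
  using has_mellin_power_bounded[OF power_bounded_complex_powr, of s z w] assms
  by (simp add: mellin_powr)

lemma mellin_tendsto_0:
  assumes f: "power_bounded a f" and s: "Re s + a > 0"
  shows "((\<lambda>x. mellin f s (of_real x)) \<longlongrightarrow> 0) at_top"
proof -
  have fm: "f \<in> borel_measurable (lebesgue_on {0<..})"
    using f by (simp add: power_bounded_def)
  let ?h = "\<lambda>x t. complex_of_real t powr (s - 1) * exp (- of_real x * of_real t) * f t"
  have "((\<lambda>x. \<integral>t. ?h x t \<partial>lebesgue_on {0<..}) \<longlongrightarrow> (\<integral>t. 0 \<partial>lebesgue_on {0::real<..})) at_top"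
  proof (rule integral_dominated_convergence_at_top[where s = ?h and w = "\<lambda>t. norm (?h 1 t)" and f = "\<lambda>_. 0" and M = "lebesgue_on {0<..}"])
    show "integrable (lebesgue_on {0<..}) (\<lambda>t. norm (?h 1 t))"
      by (intro integrable_norm) (use mellin_integrable[OF f s, of 1] in simp)
    show "?h x \<in> borel_measurable (lebesgue_on {0<..})" for x
      by (rule mellin_integrand_measurable[OF fm])
    show "\<forall>\<^sub>F x in at_top. AE t in lebesgue_on {0<..}. norm (?h x t) \<le> norm (?h 1 t)"
      using eventually_ge_at_top[of 1]
    proof eventually_elim
      case (elim x)
      show ?case
      proof (rule AE_I2)
        fix t :: real assume "t \<in> space (lebesgue_on {0<..})"
        then have "- x * t \<le> - 1 * t" using elim by (intro mult_right_mono) auto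
        then show "norm (?h x t) \<le> norm (?h 1 t)"
          unfolding norm_mult by (intro mult_right_mono mult_left_mono) auto
      qed
    qed
    show "AE t in lebesgue_on {0<..}. ((\<lambda>x. ?h x t) \<longlongrightarrow> 0) at_top"
    proof (rule AE_I2)
      fix t :: real assume "t \<in> space (lebesgue_on {0<..})"
      then have t: "t > 0" by simp
      have "((\<lambda>x. exp (- x * t)) \<longlongrightarrow> 0) at_top" using t by real_asymp
      then have "((\<lambda>x. complex_of_real (exp (- x * t))) \<longlongrightarrow> of_real 0) at_top" by (rule tendsto_of_real)
      then have "((\<lambda>x. of_real t powr (s - 1) * complex_of_real (exp (- x * t)) * f t) \<longlongrightarrow> of_real t powr (s - 1) * of_real 0 * f t) at_top"
        by (rule tendsto_mult[OF tendsto_mult[OF tendsto_const] tendsto_const])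
      then show "((\<lambda>x. ?h x t) \<longlongrightarrow> 0) at_top" by (simp add: exp_of_real[symmetric])
    qed
  qed auto
  then show ?thesis by (simp add: mellin_def)
qed

section \<open>Continuation of Mellin transforms of kernels with a pole at the origin\<close>

text \<open>
  A kernel with a formal expansion $\sum_n b_n t^{n-2}$ at $0$.  The remainder is required to
  be $O(t^{N-2})$ on all of $(0,\infty)$; for $N \geq 2$ this costs nothing at infinity as soon as the
  kernel is bounded there, because then all subtracted powers are dominated by $t^{N-2}$.
\<close>

locale mellin_kernel =
  fixes \<kappa> :: "real \<Rightarrow> complex" and b :: "nat \<Rightarrow> complex"
  assumes remainder_bounded:
    "N \<ge> 2 \<Longrightarrow> power_bounded (real N - 2) (\<lambda>t. \<kappa> t - (\<Sum>n<N. b n * of_real t powr (of_nat n - 2)))"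
begin

definition remainder :: "nat \<Rightarrow> real \<Rightarrow> complex" where
  "remainder N t = \<kappa> t - (\<Sum>n<N. b n * of_real t powr (of_nat n - 2))"

text \<open>
  The Mellin transform of the subtracted terms in closed form; unlike the integrals it makes
  sense on the whole plane, apart from poles.
\<close>

definition principal_part :: "nat \<Rightarrow> complex \<Rightarrow> complex \<Rightarrow> complex" where
  "principal_part N s w = (\<Sum>n<N. b n * (Gamma (s + of_nat n - 2) * w powr (2 - s - of_nat n)))"

definition continuation_from :: "nat \<Rightarrow> complex \<Rightarrow> complex \<Rightarrow> complex" where
  "continuation_from N s w = rGamma s * (principal_part N s w + mellin (remainder N) s w)"

lemma power_bounded_remainder: "N \<ge> 2 \<Longrightarrow> power_bounded (real N - 2) (remainder N)"
  using remainder_bounded[of N] by (simp add: remainder_def[abs_def])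

lemma has_mellin_remainder:
  assumes "N \<ge> 2" "Re s > 2 - real N" "Re w > 0"
  shows "has_mellin (remainder N) s w (mellin (remainder N) s w)"
  by (rule has_mellin_power_bounded[OF power_bounded_remainder]) (use assms in auto)

lemma has_mellin_kernel:
  assumes "N \<ge> 2" "Re s > 2" "Re w > 0"
  shows "has_mellin \<kappa> s w (principal_part N s w + mellin (remainder N) s w)"
proof -
  have "has_mellin (\<lambda>t. of_real t powr (of_nat n - 2)) s w
          (Gamma (s + of_nat n - 2) * w powr (2 - s - of_nat n))" for n
    using has_mellin_powr[of s "of_nat n - 2" w] assms by (simp add: algebra_simps)
  then have "has_mellin (\<lambda>t. (\<Sum>n<N. b n * of_real t powr (of_nat n - 2)) + remainder N t) s w
        (principal_part N s w + mellin (remainder N) s w)"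
    unfolding principal_part_def
    by (intro has_mellin_add has_mellin_sum has_mellin_cmult has_mellin_remainder) (use assms in auto)
  then show ?thesis by (simp add: remainder_def)
qed

lemma continuation_from_eq_mellin:
  assumes "N \<ge> 2" "Re s > 2" "Re w > 0"
  shows "continuation_from N s w = rGamma s * mellin \<kappa> s w"
  using has_mellin_imp_eq[OF has_mellin_kernel[OF assms]] by (simp add: continuation_from_def)

lemma continuation_from_Suc:
  assumes N: "N \<ge> 2" and s: "Re s > 2 - real N" and w: "Re w > 0"
  shows "continuation_from (Suc N) s w = continuation_from N s w"
proof -
  have eq: "remainder N = (\<lambda>t. remainder (Suc N) t + b N * of_real t powr (of_nat N - 2))"
    by (simp add: remainder_def fun_eq_iff)
  have "has_mellin (remainder N) s w
          (mellin (remainder (Suc N)) s w + b N * (Gamma (s + of_nat N - 2) * w powr (2 - s - of_nat N)))"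
    unfolding eq
  proof (intro has_mellin_add has_mellin_cmult)
    show "has_mellin (remainder (Suc N)) s w (mellin (remainder (Suc N)) s w)"
      by (rule has_mellin_remainder) (use assms in auto)
    show "has_mellin (\<lambda>t. of_real t powr (of_nat N - 2)) s w
          (Gamma (s + of_nat N - 2) * w powr (2 - s - of_nat N))"
      using has_mellin_powr[of s "of_nat N - 2" w] s w by (simp add: algebra_simps)
  qed
  from has_mellin_imp_eq[OF this] show ?thesis
    by (simp add: continuation_from_def principal_part_def)
qed

lemma continuation_from_indep:
  assumes "N \<ge> 2" "N \<le> N'" "Re s > 2 - real N" "Re w > 0"
  shows "continuation_from N' s w = continuation_from N s w"
  using assms(2)
proof (induction N' rule: dec_induct)
  case (step n)
  then show ?case using continuation_from_Suc[of n s w] assms by auto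
qed simp

text \<open>
  For each $s$ some number of subtracted terms that is large enough; by \<open>continuation_from_indep\<close> the
  choice does not matter.
\<close>

definition continuation :: "complex \<Rightarrow> complex \<Rightarrow> complex" where
  "continuation w s = continuation_from (nat \<lceil>3 - Re s\<rceil> + 2) s w"

lemma continuation_eq:
  assumes "N \<ge> 2" "Re s > 2 - real N" "Re w > 0"
  shows "continuation w s = continuation_from N s w"
proof -
  define N' where "N' = nat \<lceil>3 - Re s\<rceil> + 2"
  have N': "N' \<ge> 2" "Re s > 2 - real N'"
    unfolding N'_def by (auto, linarith)
  show ?thesis
  proof (cases "N \<le> N'")
    case True
    then show ?thesis
      using continuation_from_indep[of N N' s w] assms by (simp add: continuation_def N'_def)
  next
    case False
    then show ?thesis
      using continuation_from_indep[of N' N s w] N' assms by (simp add: continuation_def N'_def)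
  qed
qed

lemma continuation_from_meromorphic:
  assumes "N \<ge> 2" "Re w > 0"
  shows "(\<lambda>s. continuation_from N s w) meromorphic_on {s. Re s > 2 - real N}"
proof -
  have 1: "(\<lambda>s. mellin (remainder N) s w) meromorphic_on {s. Re s > 2 - real N}"
    using mellin_holomorphic_s[OF power_bounded_remainder[of N], of w] assms
    by (intro analytic_on_imp_meromorphic_on) (auto simp: analytic_on_open open_halfspace_Re_gt)
  have 2: "(\<lambda>s. Gamma (s + of_nat n - 2)) meromorphic_on A" for n A
    by (rule meromorphic_on_compose[OF meromorphic_Gamma[of UNIV]]) (auto intro!: analytic_intros)
  have 3: "(\<lambda>s. w powr (2 - s - of_nat n)) meromorphic_on A" for n A
    using assms by (intro analytic_on_imp_meromorphic_on analytic_intros) (auto simp: complex_nonpos_Reals_iff)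
  show ?thesis
    unfolding continuation_from_def principal_part_def
    by (intro meromorphic_intros 1 2 3 analytic_on_imp_meromorphic_on[of rGamma] analytic_rGamma)
qed

lemma continuation_meromorphic:
  assumes w: "Re w > 0"
  shows "continuation w meromorphic_on UNIV"
proof (subst meromorphic_on_meromorphic_at, intro ballI)
  fix s0 :: complex
  define N where "N = nat \<lceil>3 - Re s0\<rceil> + 2"
  have N: "N \<ge> 2" "Re s0 > 2 - real N"
    unfolding N_def by (auto, linarith)
  have "(\<lambda>s. continuation_from N s w) meromorphic_on {s0}"
    by (rule meromorphic_on_subset[OF continuation_from_meromorphic]) (use N w in auto)
  moreover have "\<forall>\<^sub>F s in at s0. continuation w s = continuation_from N s w"
  proof -
    have "\<forall>\<^sub>F s in nhds s0. s \<in> {s. Re s > 2 - real N}"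
      by (intro eventually_nhds_in_open open_halfspace_Re_gt) (use N in auto)
    then have "\<forall>\<^sub>F s in nhds s0. continuation w s = continuation_from N s w"
      by eventually_elim (use N w in \<open>auto intro: continuation_eq\<close>)
    then show ?thesis by (simp add: eventually_at_filter eventually_mono)
  qed
  ultimately show "continuation w meromorphic_on {s0}"
    by (subst meromorphic_on_cong) auto
qed

text \<open>
  The continuation with three subtracted terms, after cancelling $1/\Gamma(s)$ against
  $\Gamma(s-2)$, $\Gamma(s-1)$, $\Gamma(s)$.  The cancelled form has no singularity at $s = 0$, where
  the uncancelled one is falsified by the default value $0$ of $\Gamma$ at its poles.
\<close>

definition zeta :: "complex \<Rightarrow> complex \<Rightarrow> complex" where
  "zeta w s = b 0 * w powr (2 - s) / ((s - 1) * (s - 2)) + b 1 * w powr (1 - s) / (s - 1)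
     + b 2 * w powr (- s) + rGamma s * mellin (remainder 3) s w"

lemma continuation_eq_zeta:
  assumes s: "Re s > -1" "s \<notin> {0, 1, 2}" and w: "Re w > 0"
  shows "continuation w s = zeta w s"
proof -
  \<comment> \<open>0 is the only non-positive integer to the right of -1\<close>
  have ns: "s \<notin> \<int>\<^sub>\<le>\<^sub>0"
  proof
    assume "s \<in> \<int>\<^sub>\<le>\<^sub>0"
    then obtain n where "s = - of_nat n" by (elim nonpos_Ints_cases')
    then show False using s by auto
  qed
  have rG: "rGamma s \<noteq> 0" using ns by (simp add: rGamma_eq_zero_iff)
  have G: "Gamma z = inverse (rGamma z)" for z :: complex
    by (simp add: rGamma_inverse_Gamma)
  have 0: "rGamma s * Gamma s = 1" using rG by (simp add: G)
  have "rGamma (s - 1) = (s - 1) * rGamma s" using rGamma_plus1[of "s - 1"] by simp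
  moreover from this have "rGamma (s - 2) = (s - 2) * ((s - 1) * rGamma s)"
    using rGamma_plus1[of "s - 2"] by simp
  ultimately have 1: "rGamma s * Gamma (s - 1) = 1 / (s - 1)"
    and 2: "rGamma s * Gamma (s - 2) = 1 / ((s - 1) * (s - 2))"
    using rG s by (simp_all add: G divide_simps)
  have "continuation w s = continuation_from 3 s w"
    by (rule continuation_eq) (use s w in auto)
  also have "\<dots> = b 0 * (rGamma s * Gamma (s - 2)) * w powr (2 - s) + b 1 * (rGamma s * Gamma (s - 1)) * w powr (1 - s)
     + b 2 * (rGamma s * Gamma s) * w powr (- s) + rGamma s * mellin (remainder 3) s w"
    by (simp add: continuation_from_def principal_part_def eval_nat_numeral algebra_simps)
  also have "\<dots> = zeta w s"
    unfolding 0 1 2 zeta_def by simp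
  finally show ?thesis .
qed

lemma zeta_holomorphic:
  assumes "Re w > 0"
  shows "zeta w holomorphic_on ({s. Re s > -1} - {1, 2})"
proof -
  have "(\<lambda>s. mellin (remainder 3) s w) holomorphic_on ({s. Re s > -1} - {1, 2})"
    by (rule holomorphic_on_subset[OF mellin_holomorphic_s[OF power_bounded_remainder[of 3]]])
       (use assms in auto)
  then show ?thesis
    unfolding zeta_def using assms
    by (intro holomorphic_intros) auto
qed

lemma zeta_domain: "open ({s. Re s > -1} - {1, 2})" "connected ({s. Re s > -1} - {1, 2})"
proof -
  show "open ({s. Re s > -1} - {1, 2})"
    by (intro open_Diff open_halfspace_Re_gt) auto
  show "connected ({s. Re s > -1} - {1, 2})"
    by (intro connected_open_delete_finite open_halfspace_Re_gt) (auto simp: convex_connected convex_halfspace_Re_gt)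
qed

lemma remove_sings_continuation:
  assumes s: "s \<in> {s. Re s > -1} - {1, 2}" and w: "Re w > 0"
  shows "remove_sings (continuation w) s = zeta w s"
proof (rule remove_sings_eqI)
  have "\<forall>\<^sub>F z in at s. z \<in> {s. Re s > -1} - {1, 2} \<and> z \<noteq> 0"
  proof (rule eventually_conj)
    show "\<forall>\<^sub>F z in at s. z \<in> {s. Re s > -1} - {1, 2}"
      by (rule eventually_at_in_open'[OF zeta_domain(1) s])
    show "\<forall>\<^sub>F z in at s. z \<noteq> 0"
      by (cases "s = 0") (auto simp: eventually_neq_at_within)
  qed
  then have "\<forall>\<^sub>F z in at s. continuation w z = zeta w z"
    by eventually_elim (use w in \<open>auto intro: continuation_eq_zeta\<close>)
  moreover have "zeta w \<midarrow>s\<rightarrow> zeta w s"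
    using zeta_holomorphic[OF w] zeta_domain(1) s
    by (meson continuous_on_eq_continuous_at holomorphic_on_imp_continuous_on isContD)
  ultimately show "continuation w \<midarrow>s\<rightarrow> zeta w s"
    by (simp add: tendsto_cong)
qed

lemma zeta_eq_mellin:
  assumes "Re s > 2" "Re w > 0"
  shows "zeta w s = rGamma s * mellin \<kappa> s w"
proof -
  have "s \<notin> {0, 1, 2}" using assms by auto
  then have "zeta w s = continuation_from 3 s w"
    using continuation_eq_zeta[of s w] continuation_eq[of 3 s w] assms by auto
  then show ?thesis using continuation_from_eq_mellin[of 3 s w] assms by simp
qed

text \<open>
  The derivative of the zeta function of the kernel at $s = 0$.  The remainder enters only through its value there,
  since $1/\Gamma(s)$ has a simple zero with derivative $1$.
\<close>

definition log_gamma :: "complex \<Rightarrow> complex" where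
  "log_gamma w = b 0 * w\<^sup>2 * (3 / 4 - Ln w / 2) + b 1 * w * (Ln w - 1) - b 2 * Ln w + mellin (remainder 3) 0 w"

lemma zeta_deriv_0:
  assumes w: "Re w > 0"
  shows "(zeta w has_field_derivative log_gamma w) (at 0)"
proof -
  have "((\<lambda>s. mellin (remainder 3) s w) has_field_derivative deriv (\<lambda>s. mellin (remainder 3) s w) 0) (at 0)"
    using mellin_holomorphic_s[OF power_bounded_remainder[of 3], of w] w
    by (auto intro!: holomorphic_derivI[where S = "{s. Re s > -1}"] open_halfspace_Re_gt)
  note [derivative_intros] = this
  have [simp]: "w \<noteq> 0" using w by auto
  have w2: "exp (2 * Ln w) = w\<^sup>2"
    using exp_of_nat_mult[of 2 "Ln w"] by simp
  have powr: "w powr z = exp (z * Ln w)" for z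
    by (simp add: powr_def)
  have "((rGamma :: complex \<Rightarrow> complex) has_field_derivative 1) (at 0)"
    using has_field_derivative_rGamma_nonpos_int[of 0 UNIV] by simp
  then have rG: "((\<lambda>s. rGamma s :: complex) has_field_derivative 1) (at 0)" .
  show ?thesis
    unfolding zeta_def powr
    by (rule derivative_eq_intros rG refl | simp)+
       (simp add: log_gamma_def w2 power2_eq_square, simp add: field_simps)
qed

lemma log_gamma_holomorphic: "log_gamma holomorphic_on {w. Re w > 0}"
  unfolding log_gamma_def
  using mellin_holomorphic_w[OF power_bounded_remainder[of 3], of 0]
  by (intro holomorphic_intros) (auto simp: complex_nonpos_Reals_iff)

end

text \<open>
  For $\Re s > 2$ the factor $1 - e^{-at}$ in the Mellin integral amounts to the difference of
  the transforms at $w$ and $w + a$.  This relation between zeta functions survives the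
  continuation to a neighbourhood of $0$, where it is differentiated.
\<close>

lemma log_gamma_shift:
  assumes K: "mellin_kernel \<kappa> b" "mellin_kernel \<kappa>' b'"
    and rel: "\<And>t. t > 0 \<Longrightarrow> \<kappa>' t = \<kappa> t * (1 - exp (- a * of_real t))"
    and a: "Re a \<ge> 0" and w: "Re w > 0"
  shows "mellin_kernel.log_gamma \<kappa> b w - mellin_kernel.log_gamma \<kappa> b (w + a)
           = mellin_kernel.log_gamma \<kappa>' b' w"
proof -
  interpret K1: mellin_kernel \<kappa> b by fact
  interpret K2: mellin_kernel \<kappa>' b' by fact
  have wa: "Re (w + a) > 0" using a w by simp
  let ?S = "{s. Re s > -1} - {1, 2 :: complex}"
  let ?D = "\<lambda>s. K1.zeta w s - K1.zeta (w + a) s"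
  have eq: "?D s = K2.zeta w s" if s: "s \<in> ?S" for s
  proof (rule analytic_continuation_open[of "{s. Re s > 2}" ?S ?D "K2.zeta w"])
    show "{s. Re s > 2} \<noteq> {}" by (auto intro: exI[of _ 3])
    show "?D holomorphic_on ?S"
      by (intro holomorphic_intros K1.zeta_holomorphic w wa)
    fix s assume "s \<in> {s. Re s > 2}"
    then have s: "Re s > 2" by simp
    note h1 = K1.has_mellin_kernel[of 2, OF _ s w]
    note h2 = K1.has_mellin_kernel[of 2, OF _ s wa]
    have "has_mellin (\<lambda>t. \<kappa> t - exp (- a * of_real t) * \<kappa> t) s w (mellin \<kappa> s w - mellin \<kappa> s (w + a))"
    proof (rule has_mellin_diff)
      show "has_mellin \<kappa> s w (mellin \<kappa> s w)"
        using h1 has_mellin_imp_eq[OF h1] by simp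
      show "has_mellin (\<lambda>t. exp (- a * of_real t) * \<kappa> t) s w (mellin \<kappa> s (w + a))"
        using h2 has_mellin_imp_eq[OF h2] by (simp add: has_mellin_exp_mult)
    qed
    then have "has_mellin \<kappa>' s w (mellin \<kappa> s w - mellin \<kappa> s (w + a))"
      by (subst has_mellin_cong[of _ "\<lambda>t. \<kappa> t - exp (- a * of_real t) * \<kappa> t"]) (auto simp: rel algebra_simps)
    from has_mellin_imp_eq[OF this] show "?D s = K2.zeta w s"
      by (simp add: K1.zeta_eq_mellin K2.zeta_eq_mellin s w wa flip: right_diff_distrib del: plus_complex.simps)
  next
    show "K2.zeta w holomorphic_on ?S" by (rule K2.zeta_holomorphic[OF w])
    show "open {s. Re s > 2}" by (rule open_halfspace_Re_gt)
  qed (use s K1.zeta_domain in auto)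
  have "(?D has_field_derivative (K1.log_gamma w - K1.log_gamma (w + a))) (at 0)"
    by (intro derivative_intros K1.zeta_deriv_0 w wa)
  moreover have "(?D has_field_derivative K2.log_gamma w) (at 0)"
  proof (rule has_field_derivative_transform_within_open[OF K2.zeta_deriv_0[OF w] K1.zeta_domain(1)])
    show "0 \<in> ?S" by simp
    show "K2.zeta w s = ?D s" if "s \<in> ?S" for s using eq[OF that] by simp
  qed
  ultimately show ?thesis by (rule DERIV_unique)
qed

section \<open>The kernels of the single and the double zeta function\<close>

text \<open>
  If $t^2\kappa(t)$ is analytic at $0$, the power series bounds the remainder near $0$; away from $0$ every
  term is bounded by a multiple of $t^{N-2}$.
\<close>

lemma mellin_kernelI:
  assumes meas: "\<kappa> \<in> borel_measurable (lebesgue_on {0<..})"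
    and bnd: "\<And>\<epsilon>. \<epsilon> > 0 \<Longrightarrow> \<exists>C. \<forall>t\<ge>\<epsilon>. norm (\<kappa> t) \<le> C"
    and F: "f has_fps_expansion F"
    and eq: "\<And>t. t > 0 \<Longrightarrow> \<kappa> t = f (of_real t) / (of_real t)\<^sup>2"
  shows "mellin_kernel \<kappa> (fps_nth F)"
proof
  fix N :: nat assume N: "N \<ge> 2"
  let ?b = "fps_nth F"
  let ?r = "\<lambda>t. \<kappa> t - (\<Sum>n<N. ?b n * of_real t powr (of_nat n - 2))"
  have rm: "?r \<in> borel_measurable (lebesgue_on {0<..})"
    by (intro borel_measurable_diff meas borel_measurable_sum borel_measurable_times borel_measurable_const
        continuous_imp_measurable_on_sets_lebesgue continuous_intros) (auto simp: complex_nonpos_Reals_iff)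
  have pw: "complex_of_real t powr (of_nat n - 2) = of_real t ^ n / (of_real t)\<^sup>2" if "t > 0" for t n
    using that powr_nat[of "complex_of_real t" n] powr_nat[of "complex_of_real t" 2]
    by (simp add: powr_diff)
  have pwN: "t powr (real N - 2) = t ^ N / t\<^sup>2" if "t > 0" for t
    using that by (simp add: powr_diff powr_realpow)
  define G where "G = fps_shift N F"
  from F obtain e where e: "e > 0" and R: "fps_conv_radius F > 0"
    and fe: "\<And>z. norm z < e \<Longrightarrow> eval_fps F z = f z"
    unfolding has_fps_expansion_def eventually_nhds_metric by (auto simp: dist_norm)
  obtain d where d: "d > 0" "ereal d < fps_conv_radius F"
    using ereal_dense2[OF R] by (metis ereal_less(2))
  define \<epsilon> where "\<epsilon> = min (e / 2) d"
  have \<epsilon>: "\<epsilon> > 0" "\<epsilon> < e" "\<epsilon> \<le> d" using e d by (auto simp: \<epsilon>_def)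
  have sub: "cball 0 \<epsilon> \<subseteq> eball (0::complex) (fps_conv_radius F)"
  proof
    fix z :: complex assume "z \<in> cball 0 \<epsilon>"
    then have "ereal (norm z) \<le> ereal d" using \<epsilon> by simp
    from this d(2) have "ereal (norm z) < fps_conv_radius F" by (rule le_less_trans)
    then show "z \<in> eball 0 (fps_conv_radius F)" by simp
  qed
  have "continuous_on (cball 0 \<epsilon>) (eval_fps G)"
    by (rule continuous_on_subset[OF continuous_on_eval_fps]) (use sub in \<open>simp add: G_def\<close>)
  then have "compact (eval_fps G ` cball 0 \<epsilon>)" by (rule compact_continuous_image) simp
  then obtain B where "\<forall>y\<in>eval_fps G ` cball 0 \<epsilon>. norm y \<le> B"
    by (meson compact_imp_bounded bounded_iff)
  then have B: "norm (eval_fps G z) \<le> B" if "norm z \<le> \<epsilon>" for z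
    using that by simp
  have small: "norm (?r t) \<le> B * t powr (real N - 2)" if t: "t > 0" "t \<le> \<epsilon>" for t
  proof -
    let ?z = "complex_of_real t"
    have "?z \<in> cball 0 \<epsilon>" using t by simp
    then have z: "?z \<in> eball 0 (fps_conv_radius F)" using sub by blast
    have "f ?z = eval_fps F ?z" using fe[of ?z] t \<epsilon> by simp
    also have "\<dots> = (\<Sum>n. ?b n * ?z ^ n)" by (simp add: eval_fps_def)
    also have "\<dots> = (\<Sum>n. ?b (n + N) * ?z ^ (n + N)) + (\<Sum>n<N. ?b n * ?z ^ n)"
      by (rule suminf_split_initial_segment) (use z in \<open>intro summable_fps, simp\<close>)
    also have "(\<Sum>n. ?b (n + N) * ?z ^ (n + N)) = (\<Sum>n. ?z ^ N * (fps_nth G n * ?z ^ n))"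
      by (simp add: G_def power_add mult_ac)
    also have "\<dots> = ?z ^ N * eval_fps G ?z"
      unfolding eval_fps_def
      by (rule suminf_mult) (use z in \<open>intro summable_fps, simp add: G_def\<close>)
    finally have "f ?z - (\<Sum>n<N. ?b n * ?z ^ n) = ?z ^ N * eval_fps G ?z" by simp
    moreover have "?r t = (f ?z - (\<Sum>n<N. ?b n * ?z ^ n)) / ?z\<^sup>2"
      using t by (simp add: eq pw sum_divide_distrib diff_divide_distrib)
    ultimately have "norm (?r t) = t powr (real N - 2) * norm (eval_fps G ?z)"
      using t by (simp add: norm_divide norm_mult norm_power pwN)
    also have "\<dots> \<le> t powr (real N - 2) * B"
      using t by (intro mult_left_mono B) auto
    finally show ?thesis by (simp add: mult.commute)
  qed
  obtain C where C: "\<And>t. t \<ge> \<epsilon> \<Longrightarrow> norm (\<kappa> t) \<le> C" using bnd[OF \<epsilon>(1)] by blast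
  define K where "K = \<bar>C\<bar> * \<epsilon> powr (2 - real N) + (\<Sum>n<N. norm (?b n) * \<epsilon> powr (real n - real N))"
  have large: "norm (?r t) \<le> K * t powr (real N - 2)" if t: "t \<ge> \<epsilon>" for t
  proof -
    have t0: "t > 0" using t \<epsilon> by linarith
    have mono: "t powr (real n - 2) \<le> \<epsilon> powr (real n - real N) * t powr (real N - 2)" if "n \<le> N" for n
    proof -
      have "t powr (real n - 2) = t powr (real n - real N) * t powr (real N - 2)"
        using t0 by (simp flip: powr_add)
      also have "t powr (real n - real N) \<le> \<epsilon> powr (real n - real N)"
        using that t \<epsilon> by (intro powr_mono2') auto
      finally show ?thesis by (simp add: mult_right_mono)
    qed
    have "norm (?r t) \<le> norm (\<kappa> t) + (\<Sum>n<N. norm (?b n) * t powr (real n - 2))"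
      by (rule order.trans[OF norm_triangle_ineq4 add_left_mono[OF order.trans[OF norm_sum]]])
         (use t0 in \<open>simp add: norm_mult norm_powr_real_powr\<close>)
    also have "\<dots> \<le> \<bar>C\<bar> * t powr (real 2 - 2) + (\<Sum>n<N. norm (?b n) * t powr (real n - 2))"
      using C[OF t] t0 by simp
    also have "\<dots> \<le> \<bar>C\<bar> * (\<epsilon> powr (real 2 - real N) * t powr (real N - 2)) +
        (\<Sum>n<N. norm (?b n) * (\<epsilon> powr (real n - real N) * t powr (real N - 2)))"
      by (intro add_mono mult_left_mono sum_mono mono) (use N in auto)
    also have "\<dots> = K * t powr (real N - 2)"
      by (simp add: K_def algebra_simps sum_distrib_left)
    finally show ?thesis .
  qed
  have "norm (?r t) \<le> max B K * t powr (real N - 2)" if "t > 0" for t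
  proof (cases "t \<le> \<epsilon>")
    case True
    then have "norm (?r t) \<le> B * t powr (real N - 2)" using small that by blast
    also have "\<dots> \<le> max B K * t powr (real N - 2)" by (intro mult_right_mono) auto
    finally show ?thesis .
  next
    case False
    then have "norm (?r t) \<le> K * t powr (real N - 2)" using large by simp
    also have "\<dots> \<le> max B K * t powr (real N - 2)" by (intro mult_right_mono) auto
    finally show ?thesis .
  qed
  with rm show "power_bounded (real N - 2) ?r"
    unfolding power_bounded_def by blast
qed

text \<open>
  The function $z/(1-e^{-az})$ with its singularity at $0$ removed.  It is written as a reciprocal because the
  reciprocal of a power series with nonzero constant term has an expansion.
\<close>

definition todd :: "real \<Rightarrow> complex \<Rightarrow> complex" where
  "todd a z = inverse (if z = 0 then of_real a else (1 - exp (- of_real a * z)) / z)"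

definition todd_fps :: "real \<Rightarrow> complex fps" where
  "todd_fps a = inverse (fps_shift 1 (1 - fps_exp (- of_real a)))"

lemma todd_has_fps_expansion:
  assumes "a > 0"
  shows "todd a has_fps_expansion todd_fps a"
proof -
  let ?E = "1 - fps_exp (- of_real a :: complex)"
  have E: "(\<lambda>z. 1 - exp (- of_real a * z)) has_fps_expansion ?E"
    by (intro fps_expansion_intros)
  have "?E \<noteq> 0" 
    using assms by (auto dest: arg_cong[of _ _ "\<lambda>F. fps_nth F 1"])
  then have sub: "1 \<le> subdegree ?E"
    by (intro subdegree_geI) (auto simp: less_Suc_eq)
  have "(\<lambda>z. if z = 0 then of_real a else (1 - exp (- of_real a * z)) / z ^ 1) has_fps_expansion fps_shift 1 ?E"
    by (rule has_fps_expansion_shift[OF E sub]) simp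
  then show ?thesis
    unfolding todd_def[abs_def] todd_fps_def
    by (intro has_fps_expansion_inverse) (use assms in \<open>auto simp del: One_nat_def cong: if_cong\<close>)
qed

lemma todd_fps_nth:
  assumes "a > 0"
  shows "fps_nth (todd_fps a) 0 = 1 / of_real a" "fps_nth (todd_fps a) 1 = 1 / 2"
proof -
  let ?H = "fps_shift 1 (1 - fps_exp (- of_real a :: complex))"
  have H: "fps_nth ?H 0 = of_real a" "fps_nth ?H 1 = - (of_real a)\<^sup>2 / 2"
    by (simp_all add: eval_nat_numeral)
  have "todd_fps a * ?H = 1"
    unfolding todd_fps_def by (rule inverse_mult_eq_1) (use assms H in auto)
  then have "fps_nth (todd_fps a * ?H) 0 = 1" "fps_nth (todd_fps a * ?H) 1 = 0" by simp_all
  then have 0: "fps_nth (todd_fps a) 0 * of_real a = 1"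
    and 1: "fps_nth (todd_fps a) 0 * (- (of_real a)\<^sup>2 / 2) + fps_nth (todd_fps a) 1 * of_real a = 0"
    using H by (simp_all add: fps_mult_nth del: fps_shift_nth)
  show "fps_nth (todd_fps a) 0 = 1 / of_real a" using 0 assms by (simp add: field_simps)
  then show "fps_nth (todd_fps a) 1 = 1 / 2" using 1 assms by (simp add: field_simps power2_eq_square)
qed

definition single_kernel :: "real \<Rightarrow> real \<Rightarrow> complex" where
  "single_kernel a t = 1 / (1 - exp (- of_real a * of_real t))"

lemma single_kernel_of_real: "single_kernel a t = of_real (1 / (1 - exp (- a * t)))"
  by (simp add: single_kernel_def exp_of_real flip: of_real_mult of_real_minus)

lemma single_kernel_eq_todd:
  assumes "a > 0" "t > 0"
  shows "single_kernel a t = todd a (of_real t) / of_real t"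
  using assms by (simp add: single_kernel_def todd_def)

lemma single_kernel_measurable:
  assumes "a > 0"
  shows "single_kernel a \<in> borel_measurable (lebesgue_on {0<..})"
  unfolding single_kernel_of_real[abs_def]
  by (intro continuous_imp_measurable_on_sets_lebesgue continuous_intros) (use assms in auto)

lemma single_kernel_bound:
  assumes a: "a > 0" and \<epsilon>: "\<epsilon> > 0" and t: "t \<ge> \<epsilon>"
  shows "norm (single_kernel a t) \<le> 1 / (1 - exp (- a * \<epsilon>))"
proof -
  have "exp (- a * t) \<le> exp (- a * \<epsilon>)" "exp (- a * \<epsilon>) < 1" using assms by auto
  then have "\<bar>1 / (1 - exp (- a * t))\<bar> \<le> 1 / (1 - exp (- a * \<epsilon>))"
    by (simp add: abs_if frac_le)
  then show ?thesis unfolding single_kernel_of_real norm_of_real .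
qed

lemma mellin_kernel_single:
  assumes a: "a > 0"
  shows "mellin_kernel (single_kernel a) (fps_nth (fps_X * todd_fps a))"
proof (rule mellin_kernelI)
  show "single_kernel a \<in> borel_measurable (lebesgue_on {0<..})"
    by (rule single_kernel_measurable[OF a])
  show "\<exists>C. \<forall>t\<ge>\<epsilon>. norm (single_kernel a t) \<le> C" if "\<epsilon> > 0" for \<epsilon>
    using single_kernel_bound[OF a that] by blast
  show "(\<lambda>z. z * todd a z) has_fps_expansion fps_X * todd_fps a"
    by (intro fps_expansion_intros todd_has_fps_expansion a)
  show "single_kernel a t = of_real t * todd a (of_real t) / (of_real t)\<^sup>2" if "t > 0" for t
    using single_kernel_eq_todd[OF a that] that by (simp add: power2_eq_square)
qed

definition double_kernel :: "real \<Rightarrow> real \<Rightarrow> complex" where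
  "double_kernel \<tau> t = single_kernel 1 t * single_kernel \<tau> t"

lemma mellin_kernel_double:
  assumes \<tau>: "\<tau> > 0"
  shows "mellin_kernel (double_kernel \<tau>) (fps_nth (todd_fps 1 * todd_fps \<tau>))"
proof (rule mellin_kernelI)
  show "double_kernel \<tau> \<in> borel_measurable (lebesgue_on {0<..})"
    unfolding double_kernel_def[abs_def] using \<tau> by (intro borel_measurable_times single_kernel_measurable) auto
  show "\<exists>C. \<forall>t\<ge>\<epsilon>. norm (double_kernel \<tau> t) \<le> C" if \<epsilon>: "\<epsilon> > 0" for \<epsilon>
  proof (intro exI allI impI)
    fix t assume t: "t \<ge> \<epsilon>"
    show "norm (double_kernel \<tau> t) \<le> 1 / (1 - exp (- 1 * \<epsilon>)) * (1 / (1 - exp (- \<tau> * \<epsilon>)))"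
      unfolding double_kernel_def norm_mult
      by (intro mult_mono single_kernel_bound) (use t \<tau> \<epsilon> in auto)
  qed
  show "(\<lambda>z. todd 1 z * todd \<tau> z) has_fps_expansion todd_fps 1 * todd_fps \<tau>"
    by (intro fps_expansion_intros todd_has_fps_expansion) (use \<tau> in auto)
  show "double_kernel \<tau> t = todd 1 (of_real t) * todd \<tau> (of_real t) / (of_real t)\<^sup>2" if "t > 0" for t
    using single_kernel_eq_todd[OF _ that] that \<tau> by (simp add: power2_eq_square double_kernel_def)
qed

text \<open>
  The trivial kernel, whose zeta function is $w^{-s}$.  Multiplying the single kernel by
  $1 - e^{-at}$ gives this one, which is the source of the term $\log w$ in the functional
  equation of the gamma function.
\<close>

lemma mellin_kernel_unit: "mellin_kernel (\<lambda>_. 1) (\<lambda>n. if n = 2 then 1 else 0)"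
proof
  fix N :: nat assume N: "N \<ge> 2"
  show "power_bounded (real N - 2)
     (\<lambda>t. 1 - (\<Sum>n<N. (if n = 2 then 1 else 0) * complex_of_real t powr (of_nat n - 2)))"
  proof (cases "N = 2")
    case True
    then show ?thesis using power_bounded_1 by (simp add: lessThan_Suc numeral_2_eq_2 sum.neutral)
  next
    case False
    then have "(\<Sum>n<N. (if n = 2 then 1 else 0) * complex_of_real t powr (of_nat n - 2)) = complex_of_real t powr 0" for t
      using N by (subst sum.remove[of _ 2]) (auto intro!: sum.neutral)
    moreover have "power_bounded (real N - 2) (\<lambda>t. 1 - of_real t powr 0)"
      unfolding power_bounded_def
    proof
      show "(\<lambda>t. 1 - complex_of_real t powr 0) \<in> borel_measurable (lebesgue_on {0<..})"
        by (intro continuous_imp_measurable_on_sets_lebesgue continuous_intros) (auto simp: complex_nonpos_Reals_iff)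
      show "\<exists>C. \<forall>t>0. norm (1 - complex_of_real t powr 0) \<le> C * t powr (real N - 2)"
        by (intro exI[of _ 0]) auto
    qed
    ultimately show ?thesis by simp
  qed
qed

lemma log_gamma_unit:
  assumes "Re w > 0"
  shows "mellin_kernel.log_gamma (\<lambda>_. 1) (\<lambda>n. if n = 2 then 1 else 0) w = - Ln w"
proof -
  interpret mellin_kernel "\<lambda>_. 1" "\<lambda>n. if n = 2 then 1 else 0" by (rule mellin_kernel_unit)
  have "remainder 3 t = 0" if "t > 0" for t
    proof -
    have "{..<3::nat} = {0, 1, 2}" by auto
    then show ?thesis using that by (simp add: remainder_def)
  qed
  then have "mellin (remainder 3) 0 w = 0"
    unfolding mellin_def by (intro integral_eq_zero_AE AE_I2) auto
  then show ?thesis by (simp add: log_gamma_def)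
qed

lemma single_kernel_mult:
  assumes "a > 0" "t > 0"
  shows "single_kernel a t * (1 - exp (- of_real a * of_real t)) = 1"
proof -
  have "exp (- a * t) \<noteq> 1" using assms by simp
  then have "exp (- complex_of_real a * of_real t) \<noteq> 1"
    by (metis exp_of_real of_real_eq_1_iff of_real_minus of_real_mult)
  then show ?thesis by (simp add: single_kernel_def)
qed

section \<open>The single gamma function of period a\<close>

text \<open>
  Stirling's approximation to $\Gamma(x)$ without the factor $\sqrt{2\pi}$.
\<close>

definition stirling :: "real \<Rightarrow> real" where
  "stirling x = exp (x * (ln x - 1) - ln x / 2)"

lemma Gamma_series_asymp:
  assumes x: "x > 0"
  shows "(\<lambda>n. fact n * real n powr x / Gamma (x + real n + 1)) \<longlonglongrightarrow> 1"
proof -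
  have x0: "x \<notin> \<int>\<^sub>\<le>\<^sub>0" using x by (auto elim!: nonpos_Ints_cases)
  have G: "Gamma x \<noteq> 0" using x0 by (simp add: Gamma_eq_zero_iff)
  have "(\<lambda>n. Gamma_series x n / Gamma x) \<longlonglongrightarrow> Gamma x / Gamma x"
    by (intro tendsto_intros Gamma_series_LIMSEQ G)
  moreover have "\<forall>\<^sub>F n in sequentially. Gamma_series x n / Gamma x = fact n * real n powr x / Gamma (x + real n + 1)"
    using eventually_gt_at_top[of 0]
  proof eventually_elim
    case (elim n)
    then show ?case
      using pochhammer_Gamma[OF x0, of "n + 1"] G
      by (simp add: Gamma_series_def powr_def add_ac field_simps)
  qed
  ultimately show ?thesis using G by (simp add: tendsto_cong)
qed

text \<open>
  Gauss' product shows that adding $x$ to the argument $n + 1$ of $\Gamma$ contributes a factor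
  asymptotic to $n^x$; for Stirling's expression this is elementary.  So the limit cannot depend
  on $x$.
\<close>

lemma stirling_limit_independent:
  fixes c :: "real \<Rightarrow> complex"
  assumes c: "\<And>x. x > 0 \<Longrightarrow> (\<lambda>n. of_real (stirling (x + real n) / Gamma (x + real n))) \<longlonglongrightarrow> c x"
    and x: "x > 0"
  shows "c x = c 1"
proof -
  have 1: "(\<lambda>n. stirling (x + real n + 1) / (stirling (real n + 1) * real n powr x)) \<longlonglongrightarrow> 1"
    unfolding stirling_def using x by real_asymp
  have 2: "(\<lambda>n. real n powr x * fact n / Gamma (x + real n + 1)) \<longlonglongrightarrow> 1"
    using Gamma_series_asymp[OF x] by (simp add: mult.commute)
  have "(\<lambda>n. of_real (stirling (1 + real n) / Gamma (1 + real n)) *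
         of_real (stirling (x + real n + 1) / (stirling (real n + 1) * real n powr x)) *
         of_real (real n powr x * fact n / Gamma (x + real n + 1))) \<longlonglongrightarrow> c 1 * of_real 1 * of_real 1"
    by (intro tendsto_intros c tendsto_of_real 1 2) auto
  moreover have "\<forall>\<^sub>F n in sequentially. of_real (stirling (1 + real n) / Gamma (1 + real n)) *
         of_real (stirling (x + real n + 1) / (stirling (real n + 1) * real n powr x)) *
         of_real (real n powr x * fact n / Gamma (x + real n + 1))
      = complex_of_real (stirling (x + real (Suc n)) / Gamma (x + real (Suc n)))"
    using eventually_gt_at_top[of 0]
  proof eventually_elim
    case (elim n)
    have "Gamma (1 + real n) = fact n" by (simp add: Gamma_fact)
    moreover have "stirling (real n + 1) \<noteq> 0" by (simp add: stirling_def)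
    ultimately have "stirling (1 + real n) / Gamma (1 + real n) *
         (stirling (x + real n + 1) / (stirling (real n + 1) * real n powr x)) *
         (real n powr x * fact n / Gamma (x + real n + 1))
       = stirling (x + real (Suc n)) / Gamma (x + real (Suc n))"
      using elim by (simp add: add_ac)
    then show ?case by (simp only: of_real_mult[symmetric])
  qed
  ultimately have "(\<lambda>n. complex_of_real (stirling (x + real (Suc n)) / Gamma (x + real (Suc n)))) \<longlonglongrightarrow> c 1"
    by (simp add: tendsto_cong)
  moreover have "(\<lambda>n. complex_of_real (stirling (x + real (Suc n)) / Gamma (x + real (Suc n)))) \<longlonglongrightarrow> c x"
    using LIMSEQ_Suc[OF c[OF x]] .
  ultimately show ?thesis using LIMSEQ_unique by blast
qed

text \<open>
  Legendre's duplication formula relates the limits along $n$, $n + \frac12$ and $2n$.  All three are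
  equal, so it is an equation $c \cdot c / c = (2\pi)^{-1/2}$ for the common value.
\<close>

lemma stirling_limit_value:
  fixes c :: "real \<Rightarrow> complex"
  assumes c: "\<And>x. x > 0 \<Longrightarrow> (\<lambda>n. of_real (stirling (x + real n) / Gamma (x + real n))) \<longlonglongrightarrow> c x"
    and nz: "c 1 \<noteq> 0"
  shows "c 1 = 1 / of_real (sqrt (2 * pi))"
proof -
  let ?q = "\<lambda>x. stirling x / Gamma x"
  have "(\<lambda>n. complex_of_real (?q (1 + real n))) \<longlonglongrightarrow> c 1" by (rule c) auto
  then have "(\<lambda>n. complex_of_real (?q (real (Suc n)))) \<longlonglongrightarrow> c 1" by simp
  then have a: "(\<lambda>n. complex_of_real (?q (real n))) \<longlonglongrightarrow> c 1"
    by (rule LIMSEQ_imp_Suc)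
  have b: "(\<lambda>n. complex_of_real (?q (1 / 2 + real n))) \<longlonglongrightarrow> c 1"
    using c[of "1/2"] stirling_limit_independent[OF c, of "1/2"] by simp
  have d: "(\<lambda>n. complex_of_real (?q (real (2 * n)))) \<longlonglongrightarrow> c 1"
    using LIMSEQ_subseq_LIMSEQ[OF a, of "\<lambda>n. 2 * n"] by (simp add: strict_mono_def o_def)
  have "(\<lambda>n. complex_of_real (?q (real n)) * of_real (?q (1 / 2 + real n)) / of_real (?q (real (2 * n))))
      \<longlonglongrightarrow> c 1 * c 1 / c 1"
    by (intro tendsto_intros a b d nz)
  moreover have "(\<lambda>n. complex_of_real (stirling (real n) * stirling (1 / 2 + real n) / stirling (2 * real n) /
          (exp ((1 - 2 * real n) * ln 2) * sqrt pi))) \<longlonglongrightarrow> of_real (1 / sqrt (2 * pi))"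
  proof (rule tendsto_of_real)
    have sqrt2: "sqrt 2 = exp (ln 2 / 2 :: real)"
      by (simp flip: ln_sqrt)
    have "(\<lambda>n. stirling (real n) * stirling (1 / 2 + real n) / stirling (2 * real n) /
          exp ((1 - 2 * real n) * ln 2)) \<longlonglongrightarrow> 1 / sqrt 2"
      using sqrt2 unfolding stirling_def by (simp only: sqrt2 divide_inverse mult_1_left) real_asymp
    from tendsto_divide[OF this tendsto_const[of "sqrt pi"]] show "(\<lambda>n. stirling (real n) * stirling (1 / 2 + real n) / stirling (2 * real n) /
          (exp ((1 - 2 * real n) * ln 2) * sqrt pi)) \<longlonglongrightarrow> 1 / sqrt (2 * pi)"
      by (simp add: real_sqrt_mult mult_ac)
  qed
  moreover have "\<forall>\<^sub>F n in sequentially.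
      complex_of_real (?q (real n)) * of_real (?q (1 / 2 + real n)) / of_real (?q (real (2 * n)))
      = complex_of_real (stirling (real n) * stirling (1 / 2 + real n) / stirling (2 * real n) /
          (exp ((1 - 2 * real n) * ln 2) * sqrt pi))"
    using eventually_gt_at_top[of 0]
  proof eventually_elim
    case (elim n)
    have "complex_of_real (Gamma (real n) * Gamma (real n + 1 / 2))
        = Gamma (of_real (real n)) * Gamma (of_real (real n) + 1 / 2)"
      by (simp flip: Gamma_complex_of_real)
    also have "\<dots> = exp ((1 - 2 * of_real (real n)) * of_real (ln 2)) * of_real (sqrt pi) * Gamma (2 * of_real (real n))"
      by (rule Gamma_legendre_duplication; rule Re_pos_not_nonpos_Ints) (use elim in auto)
    also have "\<dots> = complex_of_real (exp ((1 - 2 * real n) * ln 2) * sqrt pi * Gamma (2 * real n))"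
      by (simp flip: Gamma_complex_of_real exp_of_real)
    finally have "Gamma (real n) * Gamma (real n + 1 / 2) = exp ((1 - 2 * real n) * ln 2) * sqrt pi * Gamma (2 * real n)"
      by (simp only: of_real_eq_iff)
    moreover have "Gamma (2 * real n) > 0" "Gamma (real n) > 0" "Gamma (real n + 1 / 2) > 0" using elim by auto
    ultimately have "Gamma (2 * real n) / (Gamma (real n) * Gamma (1 / 2 + real n)) = 1 / (exp ((1 - 2 * real n) * ln 2) * sqrt pi)"
      by (simp add: add.commute field_simps)
    moreover have "?q (real n) * ?q (1 / 2 + real n) / ?q (real (2 * n)) =
        stirling (real n) * stirling (1 / 2 + real n) / stirling (2 * real n) *
        (Gamma (2 * real n) / (Gamma (real n) * Gamma (1 / 2 + real n)))"
      by simp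
    ultimately have "?q (real n) * ?q (1 / 2 + real n) / ?q (real (2 * n)) =
        stirling (real n) * stirling (1 / 2 + real n) / stirling (2 * real n) / (exp ((1 - 2 * real n) * ln 2) * sqrt pi)"
      by simp
    then show ?case
      by (simp only: of_real_mult[symmetric] of_real_divide[symmetric])
  qed
  ultimately show ?thesis
    using nz LIMSEQ_unique by (simp add: tendsto_cong) blast
qed

definition log_gamma_single :: "real \<Rightarrow> complex \<Rightarrow> complex" where
  "log_gamma_single a = mellin_kernel.log_gamma (single_kernel a) (fps_nth (fps_X * todd_fps a))"

lemma log_gamma_single_holomorphic:
  assumes "a > 0"
  shows "log_gamma_single a holomorphic_on {w. Re w > 0}"
  unfolding log_gamma_single_def
  by (rule mellin_kernel.log_gamma_holomorphic[OF mellin_kernel_single[OF assms]])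

lemma log_gamma_single_plus:
  assumes a: "a > 0" and w: "Re w > 0"
  shows "log_gamma_single a (w + of_real a) = log_gamma_single a w + Ln w"
proof -
  have "log_gamma_single a w - log_gamma_single a (w + of_real a) = - Ln w"
    unfolding log_gamma_single_def log_gamma_unit[OF w, symmetric]
  proof (rule log_gamma_shift[OF mellin_kernel_single[OF a] mellin_kernel_unit _ _ w])
    show "1 = single_kernel a t * (1 - exp (- of_real a * of_real t))" if "t > 0" for t
      using single_kernel_mult[OF a that] by simp
  qed (use a in auto)
  then show ?thesis by (simp add: algebra_simps)
qed

text \<open>
  The expansion of $1/(1-e^{-at})$ starts with $1/(at) + 1/2$, which yields the main terms; the
  remaining integral tends to $0$ by dominated convergence.
\<close>

lemma log_gamma_single_asymp:
  assumes a: "a > 0"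
  shows "((\<lambda>x. log_gamma_single a (of_real x) - of_real (x / a * (ln x - 1) - ln x / 2)) \<longlongrightarrow> 0) at_top"
proof -
  interpret mellin_kernel "single_kernel a" "fps_nth (fps_X * todd_fps a)"
    by (rule mellin_kernel_single[OF a])
  have "((\<lambda>x. mellin (remainder 3) 0 (of_real x)) \<longlongrightarrow> 0) at_top"
    by (rule mellin_tendsto_0[OF power_bounded_remainder]) auto
  moreover have "\<forall>\<^sub>F x in at_top. mellin (remainder 3) 0 (of_real x)
     = log_gamma_single a (of_real x) - of_real (x / a * (ln x - 1) - ln x / 2)"
    using eventually_gt_at_top[of 0]
  proof eventually_elim
    case (elim x)
    have "fps_nth (fps_X * todd_fps a) 0 = 0" "fps_nth (fps_X * todd_fps a) 1 = 1 / of_real a"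
      "fps_nth (fps_X * todd_fps a) 2 = 1 / 2"
      using todd_fps_nth[OF a] by (simp_all add: numeral_2_eq_2)
    then show ?case
      unfolding log_gamma_single_def log_gamma_def using elim by (simp add: Ln_of_real)
  qed
  ultimately show ?thesis by (rule Lim_transform_eventually)
qed

text \<open>
  The quotient $c$ of the two sides (without the constant) is invariant under $x \mapsto x + 1$,
  because both satisfy the same functional equation.  Hence it equals its limit along $x + n$, which the asymptotics
  of the left-hand side express by Stirling's approximation.
\<close>

lemma exp_log_gamma_single_real:
  assumes a: "a > 0" and y: "y > 0"
  shows "exp (log_gamma_single a (of_real (a * y)))
           = of_real (a powr (y - 1 / 2) * Gamma y / sqrt (2 * pi))"
proof -
  define e where "e x = exp (log_gamma_single a (of_real (a * x)))" for x
  define c where "c x = e x / of_real (a powr (x - 1 / 2) * Gamma x)" for x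
  have e_plus: "e (x + 1) = of_real (a * x) * e x" if x: "x > 0" for x
  proof -
    have "complex_of_real (a * (x + 1)) = of_real (a * x) + of_real a" by (simp add: algebra_simps)
    then have "e (x + 1) = e x * exp (Ln (of_real (a * x)))"
      using log_gamma_single_plus[OF a, of "of_real (a * x)"] a x by (simp add: e_def exp_add)
    then show ?thesis using a x by (simp add: mult.commute)
  qed
  have c_plus: "c (x + 1) = c x" if x: "x > 0" for x
  proof -
    have "Gamma (x + 1) = x * Gamma x" by (rule Gamma_plus1) (use x in \<open>auto elim!: nonpos_Ints_cases\<close>)
    moreover have "a powr (x + 1 - 1 / 2) = a * a powr (x - 1 / 2)"
      using a by (simp add: powr_add[symmetric] powr_mult_base algebra_simps)
    ultimately show ?thesis
      unfolding c_def e_plus[OF x] using a x by simp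
  qed
  have c_nat: "c (x + real n) = c x" if "x > 0" for x n
  proof (induction n)
    case (Suc n)
    then show ?case using c_plus[of "x + real n"] that by (simp add: add_ac)
  qed simp
  \<comment> \<open>the constant c x equals c at x + n, where the Binet remainder is negligible\<close>
  have lim: "(\<lambda>n. of_real (stirling (x + real n) / Gamma (x + real n))) \<longlonglongrightarrow> c x" if x: "x > 0" for x
  proof -
    let ?R = "\<lambda>z. log_gamma_single a (of_real z) - of_real (z / a * (ln z - 1) - ln z / 2)"
    have "filterlim (\<lambda>n. a * (x + real n)) at_top sequentially" using a by real_asymp
    from filterlim_compose[OF log_gamma_single_asymp[OF a] this]
    have "(\<lambda>n. ?R (a * (x + real n))) \<longlonglongrightarrow> 0" .
    then have "(\<lambda>n. c x / exp (?R (a * (x + real n)))) \<longlonglongrightarrow> c x / exp 0"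
      by (intro tendsto_intros) auto
    moreover have "c x / exp (?R (a * (x + real n))) = of_real (stirling (x + real n) / Gamma (x + real n))" for n
    proof -
      define z where "z = x + real n"
      have z: "z > 0" using x by (simp add: z_def)
      have "a * z / a * (ln (a * z) - 1) - ln (a * z) / 2 = (z * (ln z - 1) - ln z / 2) + (z - 1 / 2) * ln a"
        using a z by (simp add: ln_mult field_simps)
      then have "exp (a * z / a * (ln (a * z) - 1) - ln (a * z) / 2) = stirling z * a powr (z - 1 / 2)"
        using a by (simp add: stirling_def powr_def exp_add)
      then have "exp (?R (a * z)) = e z / of_real (stirling z * a powr (z - 1 / 2))"
        unfolding exp_diff exp_of_real e_def by (rule arg_cong)
      then have "c z / exp (?R (a * z)) = of_real (stirling z / Gamma z)"
        using a z by (simp add: c_def e_def stirling_def)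
      then show ?thesis using c_nat[OF x, of n] by (simp add: z_def)
    qed
    ultimately show ?thesis by simp
  qed
  have nz: "c 1 \<noteq> 0" using a by (simp add: c_def e_def)
  have "c y = 1 / of_real (sqrt (2 * pi))"
    using stirling_limit_independent[OF lim y] stirling_limit_value[OF lim nz] by simp
  moreover have "Gamma y \<noteq> 0" using y by (simp add: Gamma_real_pos less_imp_neq[symmetric])
  ultimately show ?thesis using a by (simp add: c_def e_def field_simps)
qed

lemma exp_log_gamma_single:
  assumes a: "a > 0" and w: "Re w > 0"
  shows "exp (log_gamma_single a w)
           = of_real a powr (w / of_real a - 1 / 2) * Gamma (w / of_real a) / of_real (sqrt (2 * pi))"
proof (rule holomorphic_eq_right_halfplane[OF _ _ _ w])
  show "(\<lambda>w. exp (log_gamma_single a w)) holomorphic_on {w. Re w > 0}"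
    by (intro holomorphic_intros log_gamma_single_holomorphic a)
  show "(\<lambda>w. of_real a powr (w / of_real a - 1 / 2) * Gamma (w / of_real a) / of_real (sqrt (2 * pi))) holomorphic_on {w. Re w > 0}"
  proof (intro holomorphic_intros)
    fix w :: complex assume "w \<in> {w. Re w > 0}"
    then have "Re (w / of_real a) > 0" using a by simp
    then show "w / of_real a \<notin> \<int>\<^sub>\<le>\<^sub>0" by (rule Re_pos_not_nonpos_Ints)
  qed (use a in auto)
  fix x :: real assume x: "x > 0"
  have "complex_of_real a powr (of_real x / of_real a - 1 / 2) = of_real (a powr (x / a - 1 / 2))"
    using a powr_of_real[of a "x / a - 1 / 2"] by simp
  moreover have "Gamma (complex_of_real x / of_real a) = of_real (Gamma (x / a))"
    by (simp flip: Gamma_complex_of_real of_real_divide)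
  ultimately show "exp (log_gamma_single a (of_real x)) =
     of_real a powr (of_real x / of_real a - 1 / 2) * Gamma (of_real x / of_real a) / of_real (sqrt (2 * pi))"
    using exp_log_gamma_single_real[OF a, of "x / a"] a x by simp
qed

section \<open>The Barnes double zeta function\<close>

definition log_gamma_double :: "real \<Rightarrow> complex \<Rightarrow> complex" where
  "log_gamma_double \<tau> = mellin_kernel.log_gamma (double_kernel \<tau>) (fps_nth (todd_fps 1 * todd_fps \<tau>))"

lemma log_gamma_double_holomorphic:
  assumes "\<tau> > 0"
  shows "log_gamma_double \<tau> holomorphic_on {w. Re w > 0}"
  unfolding log_gamma_double_def
  by (rule mellin_kernel.log_gamma_holomorphic[OF mellin_kernel_double[OF assms]])

text \<open>
  Removing the factor of period $1$ from the double kernel leaves the single kernel of period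
  $\tau$, and vice versa; this is why the shift by $1$ produces $\Gamma(w/\tau)$ and the shift by
  $\tau$ produces $\Gamma(w)$.
\<close>

lemma exp_log_gamma_double:
  assumes \<tau>: "\<tau> > 0" and w: "Re w > 0"
  shows "exp (log_gamma_double \<tau> w) = exp (log_gamma_double \<tau> (w + 1)) *
           (of_real \<tau> powr (w / of_real \<tau> - 1 / 2) * Gamma (w / of_real \<tau>) / of_real (sqrt (2 * pi)))"
    and "exp (log_gamma_double \<tau> w) = exp (log_gamma_double \<tau> (w + of_real \<tau>)) *
           (Gamma w / of_real (sqrt (2 * pi)))"
proof -
  have "log_gamma_double \<tau> w - log_gamma_double \<tau> (w + of_real 1) = log_gamma_single \<tau> w"
    unfolding log_gamma_double_def log_gamma_single_def
  proof (rule log_gamma_shift[OF mellin_kernel_double[OF \<tau>] mellin_kernel_single[OF \<tau>] _ _ w])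
    show "single_kernel \<tau> t = double_kernel \<tau> t * (1 - exp (- of_real 1 * of_real t))" if "t > 0" for t
      using single_kernel_mult[of 1 t] that by (simp add: double_kernel_def)
  qed auto
  then have "log_gamma_double \<tau> w = log_gamma_double \<tau> (w + 1) + log_gamma_single \<tau> w"
    by (simp add: algebra_simps)
  then show "exp (log_gamma_double \<tau> w) = exp (log_gamma_double \<tau> (w + 1)) *
           (of_real \<tau> powr (w / of_real \<tau> - 1 / 2) * Gamma (w / of_real \<tau>) / of_real (sqrt (2 * pi)))"
    by (simp add: exp_add exp_log_gamma_single[OF \<tau> w])
  have "log_gamma_double \<tau> w - log_gamma_double \<tau> (w + of_real \<tau>) = log_gamma_single 1 w"
    unfolding log_gamma_double_def log_gamma_single_def
  proof (rule log_gamma_shift[OF mellin_kernel_double[OF \<tau>] mellin_kernel_single _ _ w])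
    show "single_kernel 1 t = double_kernel \<tau> t * (1 - exp (- of_real \<tau> * of_real t))" if "t > 0" for t
      using single_kernel_mult[of \<tau> t] that \<tau> by (simp add: double_kernel_def)
  qed (use \<tau> in auto)
  then have "log_gamma_double \<tau> w = log_gamma_double \<tau> (w + of_real \<tau>) + log_gamma_single 1 w"
    by (simp add: algebra_simps)
  then show "exp (log_gamma_double \<tau> w) = exp (log_gamma_double \<tau> (w + of_real \<tau>)) *
           (Gamma w / of_real (sqrt (2 * pi)))"
    using exp_log_gamma_single[of 1 w] w by (simp add: exp_add)
qed

text \<open>
  Termwise integration of an exponential series.  The integrals of the absolute values are
  summable because their partial sums are bounded by the integral against the whole kernel.
\<close>

lemma mellin_sums:
  fixes c :: "nat \<Rightarrow> real"
  assumes c: "\<And>n. c n \<ge> 0" and w: "Re w > 0" and s: "Re s > 0"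
    and \<kappa>: "\<And>t. t > 0 \<Longrightarrow> (\<lambda>n. exp (- c n * t)) sums \<kappa> t"
    and int: "has_mellin (\<lambda>t. of_real (\<kappa> t)) s w I"
  shows "(\<lambda>n. Gamma s * (w + of_real (c n)) powr (- s)) sums I"
    and "summable (\<lambda>n. norm (Gamma s * (w + of_real (c n)) powr (- s)))"
proof -
  let ?k = "\<lambda>t. complex_of_real t powr (s - 1) * exp (- w * of_real t)"
  let ?f = "\<lambda>n t. ?k t * of_real (exp (- c n * t))"
  let ?M = "lebesgue_on {0::real<..}"
  have wc: "Re (w + of_real (c n)) > 0" for n using w c[of n] by simp
  have hm: "has_bochner_integral ?M (?f n) (Gamma s * (w + of_real (c n)) powr (- s))" for n
    using has_mellin_power_bounded[OF power_bounded_1 _ wc[of n], of s] mellin_one[OF s wc[of n]] s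
    by (simp add: has_mellin_exp_mult) (simp add: has_mellin_def exp_of_real[symmetric])
  then have fi: "integrable ?M (?f n)" for n by (auto simp: has_bochner_integral_iff)
  have Ii: "integrable ?M (\<lambda>t. ?k t * of_real (\<kappa> t))"
    using int by (auto simp: has_mellin_def has_bochner_integral_iff)
  have \<kappa>0: "\<kappa> t \<ge> 0" if "t > 0" for t
    using sums_le[OF _ sums_zero \<kappa>[OF that]] by simp
  have normf: "norm (?f n t) = norm (?k t) * exp (- c n * t)" for n t
    by (simp add: norm_mult)
  have sum_int: "summable (\<lambda>n. \<integral>t. norm (?f n t) \<partial>?M)"
  proof (rule summableI_nonneg_bounded)
    show "(\<integral>t. norm (?f n t) \<partial>?M) \<ge> 0" for n by simp
    fix n
    have "(\<Sum>i<n. \<integral>t. norm (?f i t) \<partial>?M) = (\<integral>t. (\<Sum>i<n. norm (?f i t)) \<partial>?M)"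
      by (rule Bochner_Integration.integral_sum[symmetric]) (intro integrable_norm fi)
    also have "\<dots> \<le> (\<integral>t. norm (?k t * of_real (\<kappa> t)) \<partial>?M)"
    proof (rule integral_mono)
      show "integrable ?M (\<lambda>t. \<Sum>i<n. norm (?f i t))"
        by (intro Bochner_Integration.integrable_sum integrable_norm fi)
      show "integrable ?M (\<lambda>t. norm (?k t * of_real (\<kappa> t)))"
        by (intro integrable_norm Ii)
      fix t :: real assume "t \<in> space ?M"
      then have t: "t > 0" by simp
      have "(\<Sum>i<n. exp (- c i * t)) \<le> \<kappa> t"
        using sum_le_suminf[OF sums_summable[OF \<kappa>[OF t]], of "{..<n}"] sums_unique[OF \<kappa>[OF t]] by simp
      then have "norm (?k t) * (\<Sum>i<n. exp (- c i * t)) \<le> norm (?k t) * \<kappa> t"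
        by (intro mult_left_mono) auto
      then show "(\<Sum>i<n. norm (?f i t)) \<le> norm (?k t * of_real (\<kappa> t))"
        using \<kappa>0[OF t] unfolding normf by (simp add: norm_mult sum_distrib_left)
    qed
    finally show "(\<Sum>i<n. \<integral>t. norm (?f i t) \<partial>?M) \<le> (\<integral>t. norm (?k t * of_real (\<kappa> t)) \<partial>?M)" .
  qed
  have "(\<lambda>n. \<integral>t. ?f n t \<partial>?M) sums (\<integral>t. (\<Sum>n. ?f n t) \<partial>?M)"
  proof (rule sums_integral[OF fi _ sum_int])
    show "AE t in ?M. summable (\<lambda>n. norm (?f n t))"
    proof (rule AE_I2)
      fix t :: real assume "t \<in> space ?M"
      then show "summable (\<lambda>n. norm (?f n t))"
        unfolding normf by (intro summable_mult sums_summable[OF \<kappa>]) auto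
    qed
  qed
  also have "(\<integral>t. (\<Sum>n. ?f n t) \<partial>?M) = (\<integral>t. ?k t * of_real (\<kappa> t) \<partial>?M)"
  proof (intro Bochner_Integration.integral_cong refl)
    fix t :: real assume "t \<in> space ?M"
    then have "(\<lambda>n. ?f n t) sums (?k t * of_real (\<kappa> t))"
      by (intro sums_mult sums_of_real \<kappa>) auto
    then show "(\<Sum>n. ?f n t) = ?k t * of_real (\<kappa> t)" by (rule sums_unique[symmetric])
  qed
  also have "\<dots> = I" using has_mellin_imp_eq[OF int] by (simp add: mellin_def)
  finally show "(\<lambda>n. Gamma s * (w + of_real (c n)) powr (- s)) sums I"
    using has_bochner_integral_integral_eq[OF hm] by simp
  have "norm (Gamma s * (w + of_real (c n)) powr (- s)) \<le> (\<integral>t. norm (?f n t) \<partial>?M)" for n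
    using integral_norm_bound[of ?M "?f n"] unfolding has_bochner_integral_integral_eq[OF hm] .
  then show "summable (\<lambda>n. norm (Gamma s * (w + of_real (c n)) powr (- s)))"
    by (intro summable_comparison_test[OF _ sum_int]) auto
qed

text \<open>
  The exponents $k_1 + k_2\tau$ enumerated along the pairing function, so that the double
  series becomes an ordinary one.
\<close>

definition lattice_point :: "real \<Rightarrow> nat \<Rightarrow> real" where
  "lattice_point \<tau> n = real (fst (prod_decode n)) + real (snd (prod_decode n)) * \<tau>"

lemma geometric_exp_has_sum:
  assumes "a > 0" "t > 0"
  shows "((\<lambda>k::nat. exp (- (real k * a) * t)) has_sum (1 / (1 - exp (- a * t)))) UNIV"
proof (rule sums_nonneg_imp_has_sum)
  have "(\<lambda>k. exp (- a * t) ^ k) sums (1 / (1 - exp (- a * t)))"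
    by (rule geometric_sums) (use assms in auto)
  then show "(\<lambda>k. exp (- (real k * a) * t)) sums (1 / (1 - exp (- a * t)))"
    by (simp add: exp_of_nat_mult[symmetric] mult_ac)
qed auto

lemma lattice_exp_sums:
  assumes \<tau>: "\<tau> > 0" and t: "t > 0"
  shows "(\<lambda>n. exp (- lattice_point \<tau> n * t)) sums (1 / (1 - exp (- 1 * t)) * (1 / (1 - exp (- \<tau> * t))))"
proof -
  let ?g = "\<lambda>(k1, k2). exp (- (real k1 + real k2 * \<tau>) * t)"
  let ?A = "1 / (1 - exp (- 1 * t))" and ?B = "1 / (1 - exp (- \<tau> * t))"
  have inner: "((\<lambda>k2. ?g (k1, k2)) has_sum (exp (- (real k1 * 1) * t) * ?B)) UNIV" for k1
  proof -
    have "((\<lambda>k2. exp (- (real k1 * 1) * t) * exp (- (real k2 * \<tau>) * t)) has_sum (exp (- (real k1 * 1) * t) * ?B)) UNIV"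
      by (intro has_sum_cmult_right geometric_exp_has_sum \<tau> t)
    then show ?thesis by (simp add: exp_add[symmetric] algebra_simps)
  qed
  have outer: "((\<lambda>k1. exp (- (real k1 * 1) * t) * ?B) has_sum (?A * ?B)) UNIV"
    by (intro has_sum_cmult_left geometric_exp_has_sum t) auto
  have "?g summable_on (UNIV \<times> UNIV)"
    by (rule summable_on_SigmaI[OF inner]) (use outer in \<open>auto simp: summable_on_def\<close>)
  then have "(?g has_sum (?A * ?B)) (UNIV \<times> UNIV)"
    by (intro has_sum_SigmaI[OF inner outer])
  then have "((\<lambda>n. ?g (prod_decode n)) has_sum (?A * ?B)) UNIV"
    by (subst has_sum_reindex_bij_betw[OF bij_prod_decode]) simp
  from has_sum_imp_sums[OF this] show ?thesis
    by (simp add: lattice_point_def case_prod_beta)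
qed

lemma barnes_zeta2_series_eq_mellin:
  assumes \<tau>: "\<tau> > 0" and s: "Re s > 2" and w: "Re w > 0"
  shows "barnes_zeta2_series \<tau> w s = rGamma s * mellin (double_kernel \<tau>) s w"
proof -
  interpret mellin_kernel "double_kernel \<tau>" "fps_nth (todd_fps 1 * todd_fps \<tau>)"
    by (rule mellin_kernel_double[OF \<tau>])
  let ?I = "mellin (double_kernel \<tau>) s w"
  let ?\<kappa> = "\<lambda>t. 1 / (1 - exp (- 1 * t)) * (1 / (1 - exp (- \<tau> * t)))"
  have "has_mellin (double_kernel \<tau>) s w ?I"
    using has_mellin_kernel[of 2 s w] has_mellin_imp_eq[OF has_mellin_kernel[of 2 s w]] s w by simp
  moreover have "double_kernel \<tau> = (\<lambda>t. of_real (?\<kappa> t))"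
    unfolding double_kernel_def[abs_def] single_kernel_of_real of_real_mult ..
  ultimately have int: "has_mellin (\<lambda>t. of_real (?\<kappa> t)) s w ?I" by simp
  have s0: "Re s > 0" using s by simp
  have c: "lattice_point \<tau> n \<ge> 0" for n using \<tau> by (simp add: lattice_point_def)
  have "((\<lambda>n. Gamma s * (w + of_real (lattice_point \<tau> n)) powr (- s)) has_sum ?I) UNIV"
    using mellin_sums[OF c w s0 lattice_exp_sums[OF \<tau>] int] by (intro norm_summable_imp_has_sum)
  then have "((\<lambda>n. rGamma s * (Gamma s * (w + of_real (lattice_point \<tau> n)) powr (- s))) has_sum (rGamma s * ?I)) UNIV"
    by (rule has_sum_cmult_right)
  moreover have "rGamma s * (Gamma s * z) = z" for z
    using Re_pos_not_nonpos_Ints[OF s0] by (simp add: rGamma_inverse_Gamma Gamma_eq_zero_iff)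
  ultimately have "((\<lambda>n. (w + of_real (lattice_point \<tau> n)) powr (- s)) has_sum (rGamma s * ?I)) UNIV"
    by simp
  then have "((\<lambda>n. (\<lambda>(k1, k2). (w + of_nat k1 + of_nat k2 * of_real \<tau>) powr (- s)) (prod_decode n)) has_sum (rGamma s * ?I)) UNIV"
    by (simp add: lattice_point_def case_prod_beta add.assoc)
  then have "((\<lambda>(k1, k2). (w + of_nat k1 + of_nat k2 * of_real \<tau>) powr (- s)) has_sum (rGamma s * ?I)) UNIV"
    by (subst (asm) has_sum_reindex_bij_betw[OF bij_prod_decode])
  then show ?thesis unfolding barnes_zeta2_series_def by (rule infsumI)
qed

lemma deriv_barnes_zeta2:
  assumes \<tau>: "\<tau> > 0" and w: "Re w > 0"
  shows "deriv (barnes_zeta2 \<tau> w) 0 = log_gamma_double \<tau> w"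
proof -
  interpret mellin_kernel "double_kernel \<tau>" "fps_nth (todd_fps 1 * todd_fps \<tau>)"
    by (rule mellin_kernel_double[OF \<tau>])
  define Z where "Z = remove_sings (continuation w)"
  have Z: "Z s = zeta w s" if "s \<in> {s. Re s > - 1} - {1, 2}" for s
    unfolding Z_def by (rule remove_sings_continuation[OF that w])
  have nice: "Z nicely_meromorphic_on UNIV"
    unfolding Z_def by (intro remove_sings_nicely_meromorphic continuation_meromorphic w)
  have series: "Z s = barnes_zeta2_series \<tau> w s" if "Re s > 2" for s
  proof -
    have "s \<in> {s. Re s > - 1} - {1, 2}" using that by auto
    then show ?thesis using Z zeta_eq_mellin[OF that w] barnes_zeta2_series_eq_mellin[OF \<tau> that w] by simp
  qed
  have "barnes_zeta2 \<tau> w = Z"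
    unfolding barnes_zeta2_def
  proof (rule the_equality)
    show "Z nicely_meromorphic_on UNIV \<and> (\<forall>s. Re s > 2 \<longrightarrow> Z s = barnes_zeta2_series \<tau> w s)"
      using nice series by blast
    fix f assume f: "f nicely_meromorphic_on UNIV \<and> (\<forall>s. Re s > 2 \<longrightarrow> f s = barnes_zeta2_series \<tau> w s)"
    show "f = Z"
    proof (rule nicely_meromorphic_unique[of _ _ "{s. Re s > 2}"])
      show "{s. Re s > 2} \<noteq> {}" by (auto intro: exI[of _ 3])
    qed (use f nice series open_halfspace_Re_gt in auto)
  qed
  moreover have "(Z has_field_derivative log_gamma w) (at 0)"
    by (rule has_field_derivative_transform_within_open[OF zeta_deriv_0[OF w] zeta_domain(1)]) (use Z in auto)
  ultimately show ?thesis by (simp add: DERIV_imp_deriv log_gamma_double_def)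
qed

section \<open>The double gamma function\<close>

text \<open>
  The shift by $\tau$ applied $n$ times expresses the reciprocal of the double gamma function
  at $w$ by its values at $w + n\tau$.  Working with the reciprocal keeps everything holomorphic: the
  poles of the gamma factors become zeros.
\<close>

definition recip_Gamma2 :: "real \<Rightarrow> nat \<Rightarrow> complex \<Rightarrow> complex" where
  "recip_Gamma2 \<tau> n w = (\<Prod>k<n. rGamma (w + of_nat k * of_real \<tau>) * of_real (sqrt (2 * pi)))
     * exp (- log_gamma_double \<tau> (w + of_nat n * of_real \<tau>))"

lemma recip_Gamma2_Suc:
  assumes \<tau>: "\<tau> > 0" and w: "Re w + real n * \<tau> > 0"
  shows "recip_Gamma2 \<tau> (Suc n) w = recip_Gamma2 \<tau> n w"
proof -
  let ?v = "w + of_nat n * of_real \<tau>"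
  have "Gamma ?v \<noteq> 0"
    using Re_pos_not_nonpos_Ints[of ?v] w by (simp add: Gamma_eq_zero_iff)
  then have "exp (- log_gamma_double \<tau> ?v) = rGamma ?v * of_real (sqrt (2 * pi)) * exp (- log_gamma_double \<tau> (?v + of_real \<tau>))"
    unfolding exp_minus using exp_log_gamma_double(2)[OF \<tau>, of ?v] w
    by (simp add: rGamma_inverse_Gamma field_simps)
  then show ?thesis by (simp add: recip_Gamma2_def algebra_simps)
qed

lemma recip_Gamma2_indep:
  assumes \<tau>: "\<tau> > 0" and w: "Re w + real n * \<tau> > 0" and "n \<le> m"
  shows "recip_Gamma2 \<tau> m w = recip_Gamma2 \<tau> n w"
  using assms(3)
proof (induction m rule: dec_induct)
  case (step m)
  have "real n * \<tau> \<le> real m * \<tau>" using step \<tau> by (intro mult_right_mono) auto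
  then show ?case using recip_Gamma2_Suc[OF \<tau>, of w m] w step by simp
qed simp

definition entire_recip_Gamma2 :: "real \<Rightarrow> complex \<Rightarrow> complex" where
  "entire_recip_Gamma2 \<tau> w = recip_Gamma2 \<tau> (nat \<lceil>- Re w / \<tau>\<rceil> + 1) w"

lemma entire_recip_Gamma2_eq:
  assumes \<tau>: "\<tau> > 0" and w: "Re w + real n * \<tau> > 0"
  shows "entire_recip_Gamma2 \<tau> w = recip_Gamma2 \<tau> n w"
proof -
  define m where "m = nat \<lceil>- Re w / \<tau>\<rceil> + 1"
  have "- Re w / \<tau> < real m" unfolding m_def by linarith
  then have m: "Re w + real m * \<tau> > 0" using \<tau> by (simp add: field_simps)
  show ?thesis
    using recip_Gamma2_indep[OF \<tau> w, of m] recip_Gamma2_indep[OF \<tau> m, of n]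
    by (cases "n \<le> m") (auto simp: entire_recip_Gamma2_def m_def)
qed

lemma entire_recip_Gamma2_holomorphic:
  assumes \<tau>: "\<tau> > 0"
  shows "entire_recip_Gamma2 \<tau> holomorphic_on UNIV"
proof -
  have "entire_recip_Gamma2 \<tau> analytic_on {w0}" for w0
  proof -
    define n where "n = nat \<lceil>- Re w0 / \<tau>\<rceil> + 1"
    have "- Re w0 / \<tau> < real n" unfolding n_def by linarith
    then have n: "w0 \<in> {w. Re w > - real n * \<tau>}" using \<tau> by (simp add: field_simps)
    let ?U = "{w. Re w > - real n * \<tau>}"
    have "(\<lambda>w. log_gamma_double \<tau> (w + of_nat n * of_real \<tau>)) holomorphic_on ?U"
      by (rule holomorphic_on_compose_gen[OF _ log_gamma_double_holomorphic[OF \<tau>], unfolded o_def])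
         (auto intro!: holomorphic_intros)
    then have "recip_Gamma2 \<tau> n holomorphic_on ?U"
      unfolding recip_Gamma2_def by (intro holomorphic_intros)
    then have "entire_recip_Gamma2 \<tau> holomorphic_on ?U"
      by (rule holomorphic_transform) (use entire_recip_Gamma2_eq[OF \<tau>, of _ n] in simp)
    then show ?thesis
      using n open_halfspace_Re_gt by (auto simp: analytic_at)
  qed
  then show ?thesis using analytic_on_analytic_at analytic_imp_holomorphic by blast
qed

text \<open>
  The reciprocal of an entire function is nicely meromorphic, since the value of \<open>inverse\<close> at $0$ is
  the value that niceness prescribes at a pole.
\<close>

lemma Gamma2_eq:
  assumes \<tau>: "\<tau> > 0"
  shows "Gamma2 \<tau> w = inverse (entire_recip_Gamma2 \<tau> w)"
proof -
  let ?G = "\<lambda>w. inverse (entire_recip_Gamma2 \<tau> w)"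
  have nice: "?G nicely_meromorphic_on UNIV"
    by (intro nicely_meromorphic_on_inverse analytic_on_imp_nicely_meromorphic_on)
       (use entire_recip_Gamma2_holomorphic[OF \<tau>] in \<open>simp add: analytic_on_open\<close>)
  have pos: "?G w = exp (deriv (barnes_zeta2 \<tau> w) 0)" if "Re w > 0" for w
    using entire_recip_Gamma2_eq[OF \<tau>, of w 0] that
    by (simp add: recip_Gamma2_def deriv_barnes_zeta2[OF \<tau> that] exp_minus)
  have "Gamma2 \<tau> = ?G"
    unfolding Gamma2_def
  proof (rule the_equality)
    show "?G nicely_meromorphic_on UNIV \<and> (\<forall>w. Re w > 0 \<longrightarrow> ?G w = exp (deriv (barnes_zeta2 \<tau> w) 0))"
      using nice pos by blast
    fix g assume g: "g nicely_meromorphic_on UNIV \<and> (\<forall>w. Re w > 0 \<longrightarrow> g w = exp (deriv (barnes_zeta2 \<tau> w) 0))"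
    show "g = ?G"
    proof (rule nicely_meromorphic_unique[of _ _ "{w. Re w > 0}"])
      show "{w. Re w > 0} \<noteq> {}" by (auto intro: exI[of _ 1])
    qed (use g nice pos open_halfspace_Re_gt in auto)
  qed
  then show ?thesis by simp
qed

lemma Gamma2_right_halfplane:
  assumes "\<tau> > 0" "Re w > 0"
  shows "Gamma2 \<tau> w = exp (log_gamma_double \<tau> w)"
  using entire_recip_Gamma2_eq[OF assms(1), of w 0] assms
  by (simp add: Gamma2_eq recip_Gamma2_def exp_minus)

lemma Gamma2_nonzero: "\<tau> > 0 \<Longrightarrow> Re w > 0 \<Longrightarrow> Gamma2 \<tau> w \<noteq> 0"
  by (simp add: Gamma2_right_halfplane)

lemma Gamma2_holomorphic:
  assumes "\<tau> > 0"
  shows "Gamma2 \<tau> holomorphic_on {w. Re w > 0}"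
  by (rule holomorphic_transform[of "\<lambda>w. exp (log_gamma_double \<tau> w)"])
     (auto intro!: holomorphic_intros log_gamma_double_holomorphic assms simp: Gamma2_right_halfplane assms)

lemma Gamma2_plus_1:
  assumes "\<tau> > 0" "Re w > 0"
  shows "Gamma2 \<tau> w = Gamma2 \<tau> (w + 1) *
           (of_real \<tau> powr (w / of_real \<tau> - 1 / 2) * Gamma (w / of_real \<tau>) / of_real (sqrt (2 * pi)))"
  using exp_log_gamma_double(1)[OF assms] assms by (simp add: Gamma2_right_halfplane)

text \<open>
  This equation also holds in the strip $-\tau < \Re w \leq 0$, where it is the definition of the
  extension; at a pole of $\Gamma$ both sides have the default value $0$.
\<close>

lemma Gamma2_plus_tau:
  assumes \<tau>: "\<tau> > 0" and w: "Re w > - \<tau>"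
  shows "Gamma2 \<tau> w = Gamma2 \<tau> (w + of_real \<tau>) * (Gamma w / of_real (sqrt (2 * pi)))"
  using entire_recip_Gamma2_eq[OF \<tau>, of w 1] w \<tau> Gamma2_right_halfplane[OF \<tau>, of "w + of_real \<tau>"]
  by (simp add: Gamma2_eq recip_Gamma2_def exp_minus rGamma_inverse_Gamma field_simps)

section \<open>Shifts by natural numbers\<close>

lemma Gamma_reflection_pos_real:
  fixes x :: real
  assumes "0 < x" "x < 1"
  shows "Gamma x * Gamma (1 - x) = pi / sin (pi * x)"
proof -
  have "complex_of_real (Gamma x * Gamma (1 - x)) = Gamma (of_real x) * Gamma (1 - of_real x)"
    by (simp flip: Gamma_complex_of_real)
  also have "\<dots> = of_real pi / sin (of_real pi * of_real x)"
    by (rule Gamma_reflection_complex)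
  also have "\<dots> = complex_of_real (pi / sin (pi * x))"
    by (simp flip: sin_of_real)
  finally show ?thesis by (simp only: of_real_eq_iff)
qed

lemma of_real_powr_exp:
  assumes "x > 0"
  shows "complex_of_real x powr z = exp (z * of_real (ln x))"
  using assms by (simp add: powr_def Ln_of_real)

lemma of_real_powr_of_nat:
  "x \<noteq> 0 \<Longrightarrow> complex_of_real x powr of_nat n = of_real (\<Prod>k<n. x)"
  by (simp add: powr_nat')

text \<open>
  The factor in the difference equation for the shift by $1$, on the positive real axis.
\<close>

definition shift_factor :: "real \<Rightarrow> real \<Rightarrow> real" where
  "shift_factor \<tau> x = \<tau> powr (x / \<tau> - 1 / 2) * Gamma (x / \<tau>) / sqrt (2 * pi)"

lemma shift_factor_pos: "\<tau> > 0 \<Longrightarrow> x > 0 \<Longrightarrow> shift_factor \<tau> x > 0"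
  by (auto simp: shift_factor_def intro!: divide_pos_pos mult_pos_pos)

lemma Gamma2_real_plus_1:
  assumes "\<tau> > 0" "x > 0"
  shows "Gamma2 \<tau> (of_real x) = Gamma2 \<tau> (of_real (x + 1)) * of_real (shift_factor \<tau> x)"
proof -
  have "complex_of_real \<tau> powr (of_real x / of_real \<tau> - 1 / 2) = of_real (\<tau> powr (x / \<tau> - 1 / 2))"
    using assms powr_of_real[of \<tau> "x / \<tau> - 1 / 2"] by simp
  moreover have "Gamma (complex_of_real x / of_real \<tau>) = of_real (Gamma (x / \<tau>))"
    by (simp flip: Gamma_complex_of_real of_real_divide)
  ultimately show ?thesis
    using Gamma2_plus_1[of \<tau> "of_real x"] assms by (simp add: shift_factor_def)
qed

lemma Gamma2_ratio_nat:
  assumes \<tau>: "\<tau> > 0" and x: "x - real n > 0"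
  shows "Gamma2 \<tau> (of_real (x - real n)) / Gamma2 \<tau> (of_real x)
           = of_real (\<Prod>k<n. shift_factor \<tau> (x - 1 - real k))"
  using x
proof (induction n)
  case 0
  then show ?case using Gamma2_nonzero[OF \<tau>, of "of_real x"] by simp
next
  case (Suc n)
  have step: "Gamma2 \<tau> (of_real (x - real (Suc n))) =
      Gamma2 \<tau> (of_real (x - real n)) * of_real (shift_factor \<tau> (x - 1 - real n))"
    using Gamma2_real_plus_1[OF \<tau>, of "x - real (Suc n)"] Suc.prems by (simp add: algebra_simps)
  have IH: "Gamma2 \<tau> (of_real (x - real n)) / Gamma2 \<tau> (of_real x)
      = of_real (\<Prod>k<n. shift_factor \<tau> (x - 1 - real k))"
    by (rule Suc.IH) (use Suc.prems in simp)
  show ?case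
    unfolding step prod.lessThan_Suc of_real_mult IH[symmetric] by simp
qed

lemma shift_factor_reflection:
  assumes "0 < x" "x < \<tau>"
  shows "shift_factor \<tau> x * shift_factor \<tau> (\<tau> - x) = 1 / (2 * sin (pi * (x / \<tau>)))"
proof -
  have \<tau>: "\<tau> > 0" using assms by linarith
  have "(\<tau> - x) / \<tau> = 1 - x / \<tau>" using \<tau> by (simp add: diff_divide_distrib)
  then have "shift_factor \<tau> x * shift_factor \<tau> (\<tau> - x)
      = (\<tau> powr (x / \<tau> - 1 / 2) * \<tau> powr (1 - x / \<tau> - 1 / 2)) * (Gamma (x / \<tau>) * Gamma (1 - x / \<tau>)) / (sqrt (2 * pi) * sqrt (2 * pi))"
    by (simp add: shift_factor_def)
  also have "\<tau> powr (x / \<tau> - 1 / 2) * \<tau> powr (1 - x / \<tau> - 1 / 2) = 1"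
    using \<tau> by (simp flip: powr_add)
  also have "Gamma (x / \<tau>) * Gamma (1 - x / \<tau>) = pi / sin (pi * (x / \<tau>))"
    by (rule Gamma_reflection_pos_real) (use assms \<tau> in auto)
  finally show ?thesis by simp
qed

text \<open>
  One step of the recursion is $S_2(y) = 2\sin(\pi y/\tau)\,S_2(y+1)$: both gamma quotients
  contribute a shift factor, at $y$ and at $\tau - y$, and these combine by the reflection formula.
  The bounds on $x$ keep all arguments $y$ in $(0,\tau)$, hence away from poles.
\<close>

lemma S2_ratio_nat:
  assumes \<tau>: "\<tau> > 0" and x: "x - real n > 0" "x < \<tau> + 1"
  shows "S2 \<tau> (of_real (x - real n)) / S2 \<tau> (of_real x)
           = of_real (\<Prod>k<n. 2 * sin (pi * ((x - 1 - real k) / \<tau>)))"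
  using x(1)
proof (induction n)
  case 0
  have "Gamma2 \<tau> (1 + of_real \<tau> - of_real x) \<noteq> 0" "Gamma2 \<tau> (of_real x) \<noteq> 0"
    using 0 x by (auto intro!: Gamma2_nonzero[OF \<tau>])
  then show ?case by (simp add: S2_def)
next
  case (Suc n)
  define y where "y = x - 1 - real n"
  have y: "0 < y" "y < \<tau>" using Suc.prems x(2) by (auto simp: y_def)
  have e: "x - real (Suc n) = y" "x - real n = y + 1" by (auto simp: y_def)
  have 1: "Gamma2 \<tau> (of_real y) = Gamma2 \<tau> (of_real (y + 1)) * of_real (shift_factor \<tau> y)"
    by (rule Gamma2_real_plus_1[OF \<tau> y(1)])
  have 2: "Gamma2 \<tau> (of_real (\<tau> - y)) = Gamma2 \<tau> (of_real (1 + \<tau> - y)) * of_real (shift_factor \<tau> (\<tau> - y))"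
    using Gamma2_real_plus_1[OF \<tau>, of "\<tau> - y"] y by (simp add: algebra_simps)
  have nz: "shift_factor \<tau> y > 0" "shift_factor \<tau> (\<tau> - y) > 0"
    using y \<tau> by (auto intro: shift_factor_pos)
  have sin: "2 * sin (pi * (y / \<tau>)) = 1 / (shift_factor \<tau> y * shift_factor \<tau> (\<tau> - y))"
    unfolding shift_factor_reflection[OF y] by simp
  have "S2 \<tau> (of_real y) = Gamma2 \<tau> (of_real (1 + \<tau> - y)) / Gamma2 \<tau> (of_real y)"
    by (simp add: S2_def)
  moreover have "S2 \<tau> (of_real (y + 1)) = Gamma2 \<tau> (of_real (\<tau> - y)) / Gamma2 \<tau> (of_real (y + 1))"
    by (simp add: S2_def)
  ultimately have "S2 \<tau> (of_real y) = S2 \<tau> (of_real (y + 1)) * of_real (2 * sin (pi * (y / \<tau>)))"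
    unfolding sin 1 2 using nz by simp
  then have step: "S2 \<tau> (of_real (x - real (Suc n))) = S2 \<tau> (of_real (x - real n)) * of_real (2 * sin (pi * ((x - 1 - real n) / \<tau>)))"
    unfolding e y_def[symmetric] .
  have IH: "S2 \<tau> (of_real (x - real n)) / S2 \<tau> (of_real x) = of_real (\<Prod>k<n. 2 * sin (pi * ((x - 1 - real k) / \<tau>)))"
    by (rule Suc.IH) (use Suc.prems in simp)
  show ?case
    unfolding step prod.lessThan_Suc of_real_mult IH[symmetric] by simp
qed

section \<open>The two evaluations of the product\<close>

text \<open>
  These inequalities put every argument of $\Gamma_2$ in the final formula into the right
  half-plane.  The bound on $2 \Re q$ from above is the sum of two of the upper bounds on $\Re q$;
  the remaining ones combine the bounds of the strip with the positivity assumptions.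
\<close>

lemma strip_bounds:
  assumes "\<tau> > 1" "1 + \<tau> * (1 + l1) > 0" "1 + \<tau> * (1 + l2) > 0"
    and q: "q \<in> admissible_strip \<tau> l1 l2"
  shows "Re q < \<tau>" "Re q < 1 + \<tau> * (1 + l1)" "Re q < 1 + \<tau> * (1 + l2)"
    "Re q > 1 + \<tau> * (1 + l1 + l2)" "2 * Re q > 1 + \<tau> * (1 + l1 + l2)"
    "2 * Re q < 2 + \<tau> * (2 + l1 + l2)" "Re q < 2 + \<tau> * (2 + l1 + l2)"
    "Re q > - 1 - \<tau>" "Re q > \<tau> * l1" "Re q > \<tau> * l2"
proof -
  have q': "Re q < \<tau>" "Re q < 1 + \<tau> * (1 + l1)" "Re q < 1 + \<tau> * (1 + l2)"
    "Re q > 1 + \<tau> * (1 + l1 + l2)" "2 * Re q > 1 + \<tau> * (1 + l1 + l2)"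
    using q by (auto simp: admissible_strip_def)
  then show "Re q < \<tau>" "Re q < 1 + \<tau> * (1 + l1)" "Re q < 1 + \<tau> * (1 + l2)"
    "Re q > 1 + \<tau> * (1 + l1 + l2)" "2 * Re q > 1 + \<tau> * (1 + l1 + l2)" by auto
  show "2 * Re q < 2 + \<tau> * (2 + l1 + l2)" "Re q < 2 + \<tau> * (2 + l1 + l2)"
    "Re q > - 1 - \<tau>" "Re q > \<tau> * l1" "Re q > \<tau> * l2"
    using q' assms(1-3) by (auto simp: algebra_simps)
qed

text \<open>
  After the shifts the powers of $\tau$ do not cancel factor by factor: the factor with index $k$
  carries $\tau^{(n-1-2k)/\tau}$, and only the sum of these exponents over $k < n$ vanishes.
\<close>

lemma MM_nat:
  assumes \<tau>: "\<tau> > 1" and l: "1 + \<tau> * (1 + l1) > 0" "1 + \<tau> * (1 + l2) > 0"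
    and q: "of_nat n \<in> admissible_strip \<tau> l1 l2"
  shows "MM \<tau> l1 l2 (of_nat n) = of_real (\<Prod>k<n. Gamma (1 - (real k + 1) / \<tau>) * Gamma (1 + l1 - real k / \<tau>)
                       * Gamma (1 + l2 - real k / \<tau>)
                     / (Gamma (1 - 1 / \<tau>) * Gamma (2 + l1 + l2 - (real n + real k - 1) / \<tau>)))"
proof -
  note b = strip_bounds[OF \<tau> l q, simplified]
  have \<tau>0: "\<tau> > 0" using \<tau> by simp
  let ?P = "2 * pi * \<tau> powr (1 / \<tau>) / Gamma (1 - 1 / \<tau>)"
  let ?f = "shift_factor \<tau>"
  have "Gamma (1 - 1 / \<tau>) > 0" using \<tau> by (intro Gamma_real_pos) simp
  then have G1: "Gamma (1 - 1 / \<tau>) \<noteq> 0" by linarith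
  have 1: "Gamma2 \<tau> (1 - of_nat n + of_real (\<tau> * (1 + l1))) / Gamma2 \<tau> (1 + of_real (\<tau> * (1 + l1)))
      = of_real (\<Prod>k<n. ?f (\<tau> * (1 + l1) - real k))"
    using Gamma2_ratio_nat[OF \<tau>0, of "1 + \<tau> * (1 + l1)" n] b by (simp add: algebra_simps)
  have 2: "Gamma2 \<tau> (1 - of_nat n + of_real (\<tau> * (1 + l2))) / Gamma2 \<tau> (1 + of_real (\<tau> * (1 + l2)))
      = of_real (\<Prod>k<n. ?f (\<tau> * (1 + l2) - real k))"
    using Gamma2_ratio_nat[OF \<tau>0, of "1 + \<tau> * (1 + l2)" n] b by (simp add: algebra_simps)
  have 3: "Gamma2 \<tau> (- of_nat n + of_real \<tau>) / Gamma2 \<tau> (of_real \<tau>) = of_real (\<Prod>k<n. ?f (\<tau> - 1 - real k))"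
    using Gamma2_ratio_nat[OF \<tau>0, of \<tau> n] b by simp
  have "Gamma2 \<tau> (2 - 2 * of_nat n + of_real (\<tau> * (2 + l1 + l2))) / Gamma2 \<tau> (2 - of_nat n + of_real (\<tau> * (2 + l1 + l2)))
      = of_real (\<Prod>k<n. ?f (1 - real n + \<tau> * (2 + l1 + l2) - real k))"
    using Gamma2_ratio_nat[OF \<tau>0, of "2 - real n + \<tau> * (2 + l1 + l2)" n] b by (simp add: algebra_simps)
  then have 4: "Gamma2 \<tau> (2 - of_nat n + of_real (\<tau> * (2 + l1 + l2))) / Gamma2 \<tau> (2 - 2 * of_nat n + of_real (\<tau> * (2 + l1 + l2)))
      = of_real (1 / (\<Prod>k<n. ?f (1 - real n + \<tau> * (2 + l1 + l2) - real k)))"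
    by (subst inverse_divide[symmetric]) (simp only: inverse_eq_divide of_real_divide of_real_1)
  have 5: "complex_of_real ?P powr of_nat n = of_real (\<Prod>k<n. ?P)"
    by (rule of_real_powr_of_nat) (use G1 \<tau> in auto)
  have collect: "2 * pi * t / g * (pa * ga / r) * (pb * gb / r) * (pc * gc / r) / (pd * gd / r)
      = (t * pa * pb * pc / pd) * (2 * pi / (r * r)) * (gc * ga * gb / (g * gd))"
    if "r \<noteq> 0" for t g pa ga pb gb pc gc pd gd r :: real
    using that by (simp add: mult_ac)
  have "MM \<tau> l1 l2 (of_nat n) = of_real ((\<Prod>k<n. ?P) * (\<Prod>k<n. ?f (\<tau> * (1 + l1) - real k))
      * (\<Prod>k<n. ?f (\<tau> * (1 + l2) - real k)) * (\<Prod>k<n. ?f (\<tau> - 1 - real k))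
      * (1 / (\<Prod>k<n. ?f (1 - real n + \<tau> * (2 + l1 + l2) - real k))))"
    unfolding MM_def 1 2 3 4 5 by (simp only: of_real_mult)
  also have "(\<Prod>k<n. ?P) * (\<Prod>k<n. ?f (\<tau> * (1 + l1) - real k))
      * (\<Prod>k<n. ?f (\<tau> * (1 + l2) - real k)) * (\<Prod>k<n. ?f (\<tau> - 1 - real k))
      * (1 / (\<Prod>k<n. ?f (1 - real n + \<tau> * (2 + l1 + l2) - real k)))
    = (\<Prod>k<n. ?P * ?f (\<tau> * (1 + l1) - real k) * ?f (\<tau> * (1 + l2) - real k) * ?f (\<tau> - 1 - real k)
          / ?f (1 - real n + \<tau> * (2 + l1 + l2) - real k))"
    by (simp only: prod.distrib prod_dividef) simp
  also have "\<dots> = (\<Prod>k<n. \<tau> powr ((real n - 1 - 2 * real k) / \<tau>) * (Gamma (1 - (real k + 1) / \<tau>) * Gamma (1 + l1 - real k / \<tau>)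
                       * Gamma (1 + l2 - real k / \<tau>)
                     / (Gamma (1 - 1 / \<tau>) * Gamma (2 + l1 + l2 - (real n + real k - 1) / \<tau>))))"
  proof (rule prod.cong[OF refl])
    fix k
    let ?a = "(\<tau> * (1 + l1) - real k) / \<tau>" and ?b = "(\<tau> * (1 + l2) - real k) / \<tau>" and ?c = "(\<tau> - 1 - real k) / \<tau>"
      and ?d = "(1 - real n + \<tau> * (2 + l1 + l2) - real k) / \<tau>"
    have e: "?a = 1 + l1 - real k / \<tau>" "?b = 1 + l2 - real k / \<tau>" "?c = 1 - (real k + 1) / \<tau>"
      "?d = 2 + l1 + l2 - (real n + real k - 1) / \<tau>"
      using \<tau>0 by (simp_all add: field_simps)
    have "1 / \<tau> + (?a - 1 / 2) + (?b - 1 / 2) + (?c - 1 / 2) - (?d - 1 / 2) = (real n - 1 - 2 * real k) / \<tau>"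
      using \<tau>0 by (simp add: field_simps)
    then have pw: "\<tau> powr (1 / \<tau>) * \<tau> powr (?a - 1 / 2) * \<tau> powr (?b - 1 / 2) * \<tau> powr (?c - 1 / 2) / \<tau> powr (?d - 1 / 2)
        = \<tau> powr ((real n - 1 - 2 * real k) / \<tau>)"
      by (simp only: powr_add[symmetric] powr_diff[symmetric])
    have "?P * ?f (\<tau> * (1 + l1) - real k) * ?f (\<tau> * (1 + l2) - real k) * ?f (\<tau> - 1 - real k)
          / ?f (1 - real n + \<tau> * (2 + l1 + l2) - real k)
      = (\<tau> powr (1 / \<tau>) * \<tau> powr (?a - 1 / 2) * \<tau> powr (?b - 1 / 2) * \<tau> powr (?c - 1 / 2) / \<tau> powr (?d - 1 / 2))
        * (2 * pi / (sqrt (2 * pi) * sqrt (2 * pi))) * (Gamma ?c * Gamma ?a * Gamma ?b / (Gamma (1 - 1 / \<tau>) * Gamma ?d))"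
      unfolding shift_factor_def by (rule collect) simp
    also have "2 * pi / (sqrt (2 * pi) * sqrt (2 * pi)) = 1" by simp
    finally show "?P * ?f (\<tau> * (1 + l1) - real k) * ?f (\<tau> * (1 + l2) - real k) * ?f (\<tau> - 1 - real k)
          / ?f (1 - real n + \<tau> * (2 + l1 + l2) - real k)
      = \<tau> powr ((real n - 1 - 2 * real k) / \<tau>) * (Gamma (1 - (real k + 1) / \<tau>) * Gamma (1 + l1 - real k / \<tau>)
                       * Gamma (1 + l2 - real k / \<tau>)
                     / (Gamma (1 - 1 / \<tau>) * Gamma (2 + l1 + l2 - (real n + real k - 1) / \<tau>)))"
      unfolding pw unfolding e by simp
  qed
  also have "\<dots> = (\<Prod>k<n. \<tau> powr ((real n - 1 - 2 * real k) / \<tau>)) * (\<Prod>k<n. Gamma (1 - (real k + 1) / \<tau>) * Gamma (1 + l1 - real k / \<tau>)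
                       * Gamma (1 + l2 - real k / \<tau>)
                     / (Gamma (1 - 1 / \<tau>) * Gamma (2 + l1 + l2 - (real n + real k - 1) / \<tau>)))"
    by (rule prod.distrib)
  also have "(\<Prod>k<n. \<tau> powr ((real n - 1 - 2 * real k) / \<tau>)) = \<tau> powr (\<Sum>k<n. (real n - 1 - 2 * real k) / \<tau>)"
    using \<tau>0 by (simp add: powr_sum)
  also have "(\<Sum>k<n. (real n - 1 - 2 * real k) / \<tau>) = 0"
  proof -
    have "(\<Sum>k<m. c - 2 * real k) = real m * (c - real m + 1)" for m c
      by (induction m) (auto simp: algebra_simps)
    from this[of "real n - 1" n] show ?thesis by (simp flip: sum_divide_distrib)
  qed
  finally show ?thesis using \<tau>0 by simp
qed

text \<open>
  Each sine product from $S_2$ carries a factor $2^n$; three in the numerator against one in the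
  denominator leave $4^n$, which cancels against $(4\sin(\pi/\tau))^n$.
\<close>

lemma CM_nat:
  assumes \<tau>: "\<tau> > 1" and l: "l1 < 0" "l2 < 0" "1 + \<tau> * (1 + l1) > 0" "1 + \<tau> * (1 + l2) > 0"
    and q: "of_nat n \<in> admissible_strip \<tau> l1 l2"
  shows "CM \<tau> l1 l2 (of_nat n) = complex_of_real (
          1 / fact n
          * (\<Prod>k<n. Gamma (1 - (real k + 1) / \<tau>) * Gamma (1 + l1 - real k / \<tau>)
                       * Gamma (1 + l2 - real k / \<tau>)
                     / (Gamma (1 - 1 / \<tau>)
                        * Gamma (2 + l1 + l2 - (real n + real k - 1) / \<tau>)))\<^sup>2
          * (\<Prod>k<n. sin (pi * ((real k + 1) / \<tau>)) * sin (pi * (1 + l1 - real k / \<tau>))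
                       * sin (pi * (1 + l2 - real k / \<tau>))
                     / (sin (pi / \<tau>)
                        * sin (pi * (2 + l1 + l2 - (real n + real k - 1) / \<tau>)))))"
proof -
  note b = strip_bounds[OF \<tau> l(3,4) q, simplified]
  have \<tau>0: "\<tau> > 0" using \<tau> by simp
  let ?s = "\<lambda>x. 2 * sin (pi * (x / \<tau>))"
  have \<tau>l: "\<tau> * l1 < 0" "\<tau> * l2 < 0" using l \<tau>0 by (auto simp: mult_less_0_iff)
  have 1: "S2 \<tau> (1 - of_nat n + of_real (\<tau> * (1 + l1))) / S2 \<tau> (1 + of_real (\<tau> * (1 + l1)))
      = of_real (\<Prod>k<n. ?s (\<tau> * (1 + l1) - real k))"
    using S2_ratio_nat[OF \<tau>0, of "1 + \<tau> * (1 + l1)" n] b \<tau>l by (simp add: algebra_simps)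
  have 2: "S2 \<tau> (1 - of_nat n + of_real (\<tau> * (1 + l2))) / S2 \<tau> (1 + of_real (\<tau> * (1 + l2)))
      = of_real (\<Prod>k<n. ?s (\<tau> * (1 + l2) - real k))"
    using S2_ratio_nat[OF \<tau>0, of "1 + \<tau> * (1 + l2)" n] b \<tau>l by (simp add: algebra_simps)
  have 3: "S2 \<tau> (of_real \<tau> - of_nat n) / S2 \<tau> (of_real \<tau>) = of_real (\<Prod>k<n. ?s (\<tau> - 1 - real k))"
    using S2_ratio_nat[OF \<tau>0, of \<tau> n] b by simp
  have "S2 \<tau> (2 - 2 * of_nat n + of_real (\<tau> * (2 + l1 + l2))) / S2 \<tau> (2 - of_nat n + of_real (\<tau> * (2 + l1 + l2)))
      = of_real (\<Prod>k<n. ?s (1 - real n + \<tau> * (2 + l1 + l2) - real k))"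
    using S2_ratio_nat[OF \<tau>0, of "2 - real n + \<tau> * (2 + l1 + l2)" n] b by (simp add: algebra_simps)
  then have 4: "S2 \<tau> (2 - of_nat n + of_real (\<tau> * (2 + l1 + l2))) / S2 \<tau> (2 - 2 * of_nat n + of_real (\<tau> * (2 + l1 + l2)))
      = of_real (1 / (\<Prod>k<n. ?s (1 - real n + \<tau> * (2 + l1 + l2) - real k)))"
    by (subst inverse_divide[symmetric]) (simp only: inverse_eq_divide of_real_divide of_real_1)
  have "1 / \<tau> < 1" using \<tau> by simp
  then have "pi / \<tau> < pi" using \<tau>0 by (simp add: divide_less_eq)
  then have sp: "sin (pi / \<tau>) > 0" using \<tau>0 by (intro sin_gt_zero) auto
  have 5: "complex_of_real (4 * sin (pi / \<tau>)) powr of_nat n = of_real (\<Prod>k<n. 4 * sin (pi / \<tau>))"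
    by (rule of_real_powr_of_nat) (use sp in auto)
  have 6: "Gamma (1 + of_nat n :: complex) = of_real (fact n)" by (simp add: Gamma_fact)
  have "1 + of_nat n \<notin> (\<int>\<^sub>\<le>\<^sub>0 :: complex set)"
    by (rule Re_pos_not_nonpos_Ints) simp
  then have "CM \<tau> l1 l2 (of_nat n) = CM_formula \<tau> l1 l2 (of_nat n)" by (simp add: CM_def)
  also have "\<dots> = of_real ((\<Prod>k<n. Gamma (1 - (real k + 1) / \<tau>) * Gamma (1 + l1 - real k / \<tau>)
                       * Gamma (1 + l2 - real k / \<tau>)
                     / (Gamma (1 - 1 / \<tau>) * Gamma (2 + l1 + l2 - (real n + real k - 1) / \<tau>)))\<^sup>2
     / (fact n * (\<Prod>k<n. 4 * sin (pi / \<tau>)))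
     * (\<Prod>k<n. ?s (\<tau> * (1 + l1) - real k)) * (\<Prod>k<n. ?s (\<tau> * (1 + l2) - real k))
     * (\<Prod>k<n. ?s (\<tau> - 1 - real k)) * (1 / (\<Prod>k<n. ?s (1 - real n + \<tau> * (2 + l1 + l2) - real k))))"
    unfolding CM_formula_def 1 2 3 4 5 6 MM_nat[OF \<tau> l(3,4) q]
    by (simp only: of_real_mult of_real_divide of_real_power)
  also have "\<dots> = of_real (1 / fact n * (\<Prod>k<n. Gamma (1 - (real k + 1) / \<tau>) * Gamma (1 + l1 - real k / \<tau>)
                       * Gamma (1 + l2 - real k / \<tau>)
                     / (Gamma (1 - 1 / \<tau>) * Gamma (2 + l1 + l2 - (real n + real k - 1) / \<tau>)))\<^sup>2
     * (\<Prod>k<n. ?s (\<tau> - 1 - real k) * ?s (\<tau> * (1 + l1) - real k) * ?s (\<tau> * (1 + l2) - real k)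
          / (4 * sin (pi / \<tau>) * ?s (1 - real n + \<tau> * (2 + l1 + l2) - real k))))"
    by (simp only: prod.distrib prod_dividef) simp
  also have "(\<Prod>k<n. ?s (\<tau> - 1 - real k) * ?s (\<tau> * (1 + l1) - real k) * ?s (\<tau> * (1 + l2) - real k)
          / (4 * sin (pi / \<tau>) * ?s (1 - real n + \<tau> * (2 + l1 + l2) - real k)))
    = (\<Prod>k<n. sin (pi * ((real k + 1) / \<tau>)) * sin (pi * (1 + l1 - real k / \<tau>))
                       * sin (pi * (1 + l2 - real k / \<tau>))
                     / (sin (pi / \<tau>)
                        * sin (pi * (2 + l1 + l2 - (real n + real k - 1) / \<tau>))))"
  proof (rule prod.cong[OF refl])
    fix k
    have "(\<tau> * (1 + l1) - real k) / \<tau> = 1 + l1 - real k / \<tau>" "(\<tau> * (1 + l2) - real k) / \<tau> = 1 + l2 - real k / \<tau>"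
      "(1 - real n + \<tau> * (2 + l1 + l2) - real k) / \<tau> = 2 + l1 + l2 - (real n + real k - 1) / \<tau>"
      using \<tau>0 by (simp_all add: field_simps)
    moreover have "pi * ((\<tau> - 1 - real k) / \<tau>) = pi - pi * ((real k + 1) / \<tau>)"
      using \<tau>0 by (simp add: field_simps)
    then have "sin (pi * ((\<tau> - 1 - real k) / \<tau>)) = sin (pi * ((real k + 1) / \<tau>))"
      by (simp only: sin_pi_minus)
    ultimately show "?s (\<tau> - 1 - real k) * ?s (\<tau> * (1 + l1) - real k) * ?s (\<tau> * (1 + l2) - real k)
          / (4 * sin (pi / \<tau>) * ?s (1 - real n + \<tau> * (2 + l1 + l2) - real k))
      = sin (pi * ((real k + 1) / \<tau>)) * sin (pi * (1 + l1 - real k / \<tau>)) * sin (pi * (1 + l2 - real k / \<tau>))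
        / (sin (pi / \<tau>) * sin (pi * (2 + l1 + l2 - (real n + real k - 1) / \<tau>)))"
      by simp
  qed
  finally show ?thesis .
qed

text \<open>
  The right-hand side of the second evaluation.  It is a separate constant because it must be used
  as a function of $q$: its continuity fills the removable singularities of the original formula.
\<close>

definition CM_continued :: "real \<Rightarrow> real \<Rightarrow> real \<Rightarrow> complex \<Rightarrow> complex" where
  "CM_continued \<tau> l1 l2 q =
          of_real (Gamma (1 / \<tau>) * pi * \<tau> powr (1 / \<tau>) / Gamma (1 - 1 / \<tau>)) powr q
          * Gamma (1 - q / of_real \<tau>)
          * (Gamma2 \<tau> (1 - q + of_real (\<tau> * (1 + l1))) / Gamma2 \<tau> (1 + of_real (\<tau> * (1 + l1))))
          * (Gamma2 \<tau> (1 - q + of_real (\<tau> * (1 + l2))) / Gamma2 \<tau> (1 + of_real (\<tau> * (1 + l2))))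
          * (Gamma2 \<tau> (1 - q + of_real \<tau>) / Gamma2 \<tau> (1 + of_real \<tau>))
          * (Gamma2 \<tau> (2 - q + of_real (\<tau> * (2 + l1 + l2)))
             / Gamma2 \<tau> (2 - 2 * q + of_real (\<tau> * (2 + l1 + l2))))
          * (Gamma2 \<tau> (q + 1 + of_real \<tau>) / Gamma2 \<tau> (1 + of_real \<tau>))
          * (Gamma2 \<tau> (q - of_real (\<tau> * l1)) / Gamma2 \<tau> (- of_real (\<tau> * l1)))
          * (Gamma2 \<tau> (q - of_real (\<tau> * l2)) / Gamma2 \<tau> (- of_real (\<tau> * l2)))
          * (Gamma2 \<tau> (q - 1 - of_real (\<tau> * (1 + l1 + l2)))
             / Gamma2 \<tau> (2 * q - 1 - of_real (\<tau> * (1 + l1 + l2))))"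

text \<open>
  By the reflection formula $\sin(\pi/\tau)$ in the denominator turns one of the factors
  $1/\Gamma(1-1/\tau)$ into $\Gamma(1/\tau)/\pi$; the last factor removes one of the two powers
  $\tau^{q/\tau}$.
\<close>

lemma powr_base_identity:
  assumes \<tau>: "\<tau> > 1"
  shows "(complex_of_real (2 * pi * \<tau> powr (1 / \<tau>) / Gamma (1 - 1 / \<tau>)) powr q)\<^sup>2
           / of_real (4 * sin (pi / \<tau>)) powr q * of_real \<tau> powr (- q / of_real \<tau>)
         = of_real (Gamma (1 / \<tau>) * pi * \<tau> powr (1 / \<tau>) / Gamma (1 - 1 / \<tau>)) powr q"
proof -
  let ?P = "2 * pi * \<tau> powr (1 / \<tau>) / Gamma (1 - 1 / \<tau>)" and ?s = "4 * sin (pi / \<tau>)"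
  let ?X = "Gamma (1 / \<tau>) * pi * \<tau> powr (1 / \<tau>) / Gamma (1 - 1 / \<tau>)"
  have G: "Gamma (1 - 1 / \<tau>) > 0" "Gamma (1 / \<tau>) > 0" using \<tau> by auto
  have R: "Gamma (1 / \<tau>) * Gamma (1 - 1 / \<tau>) = pi / sin (pi / \<tau>)"
    using Gamma_reflection_pos_real[of "1 / \<tau>"] \<tau> by simp
  have s: "sin (pi / \<tau>) > 0"
    using \<tau> by (intro sin_gt_zero) (auto simp: divide_less_eq)
  have sin: "sin (pi / \<tau>) = pi / (Gamma (1 / \<tau>) * Gamma (1 - 1 / \<tau>))" unfolding R using s by simp
  have P: "?P > 0" and X: "?X > 0" using G \<tau> by auto
  have ln_quot: "ln (p\<^sup>2 / u * v) = 2 * ln p - ln u + ln v" if "p > 0" "u > 0" "v > 0" for p u v :: real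
    using that by (simp add: ln_mult ln_div ln_realpow)
  have "?X = ?P\<^sup>2 / ?s * \<tau> powr (- (1 / \<tau>))"
    unfolding sin using G \<tau> by (simp add: powr_minus field_simps power2_eq_square)
  then have "ln ?X = ln (?P\<^sup>2 / ?s * \<tau> powr (- (1 / \<tau>)))" by (rule arg_cong)
  also have "\<dots> = 2 * ln ?P - ln ?s - ln \<tau> / \<tau>"
    using ln_quot[OF P, of ?s "\<tau> powr (- (1 / \<tau>))"] s \<tau> by simp
  finally have lnX: "ln ?X = 2 * ln ?P - ln ?s - ln \<tau> / \<tau>" .
  have "(complex_of_real ?P powr q)\<^sup>2 / of_real ?s powr q * of_real \<tau> powr (- q / of_real \<tau>)
      = exp (2 * (q * of_real (ln ?P)) - q * of_real (ln ?s) + (- q / of_real \<tau>) * of_real (ln \<tau>))"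
  proof -
    have "?s > 0" "\<tau> > 0" using s \<tau> by auto
    then show ?thesis
      unfolding of_real_powr_exp[OF P] of_real_powr_exp[OF \<open>?s > 0\<close>] of_real_powr_exp[OF \<open>\<tau> > 0\<close>] exp_add exp_diff
      by (simp only: exp_double)
  qed
  also have "2 * (q * of_real (ln ?P)) - q * of_real (ln ?s) + (- q / of_real \<tau>) * of_real (ln \<tau>)
      = q * of_real (2 * ln ?P - ln ?s - ln \<tau> / \<tau>)"
    by (simp add: algebra_simps)
  also have "exp (q * of_real (2 * ln ?P - ln ?s - ln \<tau> / \<tau>)) = of_real ?X powr q"
    unfolding of_real_powr_exp[OF X] lnX ..
  finally show ?thesis .
qed

text \<open>
  The only argument that may leave the right half-plane is $1 + q$.  Its real part still exceeds $-\tau$, so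
  a single shift by $\tau$ brings it back, at the price of the factor $\Gamma(1+q)$ that the formula
  divides by.
\<close>

lemma CM_formula_eq_continued:
  assumes \<tau>: "\<tau> > 1" and l: "l1 < 0" "l2 < 0" "1 + \<tau> * (1 + l1) > 0" "1 + \<tau> * (1 + l2) > 0"
    and q: "q \<in> admissible_strip \<tau> l1 l2" and nq: "1 + q \<notin> \<int>\<^sub>\<le>\<^sub>0"
  shows "CM_formula \<tau> l1 l2 q = CM_continued \<tau> l1 l2 q"
proof -
  note b = strip_bounds[OF \<tau> l(3,4) q]
  have \<tau>0: "\<tau> > 0" using \<tau> by simp
  let ?r = "complex_of_real (sqrt (2 * pi))"
  define P where "P = complex_of_real (2 * pi * \<tau> powr (1 / \<tau>) / Gamma (1 - 1 / \<tau>)) powr q"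
  define s where "s = complex_of_real (4 * sin (pi / \<tau>)) powr q"
  define A1 where "A1 = Gamma2 \<tau> (1 - q + of_real (\<tau> * (1 + l1)))"
  define a1 where "a1 = Gamma2 \<tau> (1 + of_real (\<tau> * (1 + l1)))"
  define A2 where "A2 = Gamma2 \<tau> (1 - q + of_real (\<tau> * (1 + l2)))"
  define a2 where "a2 = Gamma2 \<tau> (1 + of_real (\<tau> * (1 + l2)))"
  define A3 where "A3 = Gamma2 \<tau> (of_real \<tau> - q)"
  define a3 where "a3 = Gamma2 \<tau> (of_real \<tau>)"
  define A4 where "A4 = Gamma2 \<tau> (2 - q + of_real (\<tau> * (2 + l1 + l2)))"
  define a4 where "a4 = Gamma2 \<tau> (2 - 2 * q + of_real (\<tau> * (2 + l1 + l2)))"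
  define B1 where "B1 = Gamma2 \<tau> (q - of_real (\<tau> * l1))"
  define b1 where "b1 = Gamma2 \<tau> (- of_real (\<tau> * l1))"
  define B2 where "B2 = Gamma2 \<tau> (q - of_real (\<tau> * l2))"
  define b2 where "b2 = Gamma2 \<tau> (- of_real (\<tau> * l2))"
  define B3 where "B3 = Gamma2 \<tau> (1 + q)"
  define b3 where "b3 = Gamma2 \<tau> 1"
  define B4 where "B4 = Gamma2 \<tau> (q - 1 - of_real (\<tau> * (1 + l1 + l2)))"
  define b4 where "b4 = Gamma2 \<tau> (2 * q - 1 - of_real (\<tau> * (1 + l1 + l2)))"
  define K where "K = Gamma2 \<tau> (1 - q + of_real \<tau>)"
  define k where "k = Gamma2 \<tau> (1 + of_real \<tau>)"
  define L where "L = Gamma2 \<tau> (q + 1 + of_real \<tau>)"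
  have nz: "A1 \<noteq> 0" "a1 \<noteq> 0" "A2 \<noteq> 0" "a2 \<noteq> 0" "A3 \<noteq> 0" "a3 \<noteq> 0" "A4 \<noteq> 0" "a4 \<noteq> 0" "k \<noteq> 0"
    unfolding A1_def a1_def A2_def a2_def A3_def a3_def A4_def a4_def k_def
    using b l \<tau>0 by (auto intro!: Gamma2_nonzero[OF \<tau>0])
  have S1: "S2 \<tau> (1 - q + of_real (\<tau> * (1 + l1))) = B1 / A1" "S2 \<tau> (1 + of_real (\<tau> * (1 + l1))) = b1 / a1"
    by (simp_all add: S2_def A1_def a1_def B1_def b1_def algebra_simps)
  have S2': "S2 \<tau> (1 - q + of_real (\<tau> * (1 + l2))) = B2 / A2" "S2 \<tau> (1 + of_real (\<tau> * (1 + l2))) = b2 / a2"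
    by (simp_all add: S2_def A2_def a2_def B2_def b2_def algebra_simps)
  have S3: "S2 \<tau> (of_real \<tau> - q) = B3 / A3" "S2 \<tau> (of_real \<tau>) = b3 / a3"
    by (simp_all add: S2_def A3_def a3_def B3_def b3_def)
  have S4: "S2 \<tau> (2 - q + of_real (\<tau> * (2 + l1 + l2))) = B4 / A4"
    "S2 \<tau> (2 - 2 * q + of_real (\<tau> * (2 + l1 + l2))) = b4 / a4"
    by (simp_all add: S2_def A4_def a4_def B4_def b4_def algebra_simps)
  have M: "MM \<tau> l1 l2 q = P * (A1 / a1) * (A2 / a2) * (A3 / a3) * (A4 / a4)"
    by (simp add: MM_def P_def A1_def a1_def A2_def a2_def A3_def a3_def A4_def a4_def)
  have "CM_formula \<tau> l1 l2 q = (P * (A1 / a1) * (A2 / a2) * (A3 / a3) * (A4 / a4))\<^sup>2 / (Gamma (1 + q) * s)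
     * (B1 / A1 / (b1 / a1)) * (B2 / A2 / (b2 / a2)) * (B3 / A3 / (b3 / a3)) * (B4 / A4 / (b4 / a4))"
    unfolding CM_formula_def S1 S2' S3 S4 M s_def ..
  also have "\<dots> = P\<^sup>2 / s * (A1 / a1) * (A2 / a2) * (A4 / a4) * (B1 / b1) * (B2 / b2) * (B4 / b4)
       * (A3 / a3 * B3 / b3 / Gamma (1 + q))"
    using nz by (simp add: power2_eq_square mult_ac)
  also have "A3 / a3 * B3 / b3 / Gamma (1 + q) = of_real \<tau> powr (- q / of_real \<tau>) * Gamma (1 - q / of_real \<tau>) * (K / k) * (L / k)"
  proof -
    have G: "Gamma (1 + q) \<noteq> 0" using nq by (simp add: Gamma_eq_zero_iff)
    have d: "(of_real \<tau> - q) / of_real \<tau> = 1 - q / of_real \<tau>" using \<tau>0 by (simp add: diff_divide_distrib)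
    have A3: "A3 = K * (of_real \<tau> powr (1 - q / of_real \<tau> - 1 / 2) * Gamma (1 - q / of_real \<tau>) / ?r)"
      using Gamma2_plus_1[OF \<tau>0, of "of_real \<tau> - q"] b unfolding d by (simp add: A3_def K_def algebra_simps)
    have a3: "a3 = k * (of_real \<tau> powr (1 / 2) / ?r)"
      using Gamma2_plus_1[OF \<tau>0, of "of_real \<tau>"] \<tau>0 by (simp add: a3_def k_def add.commute)
    have B3: "B3 = L * (Gamma (1 + q) / ?r)"
      using Gamma2_plus_tau[OF \<tau>0, of "1 + q"] b by (simp add: B3_def L_def add.commute)
    have b3: "b3 = k / ?r"
      using Gamma2_plus_tau[OF \<tau>0, of 1] \<tau>0 by (simp add: b3_def k_def)
    have "1 - q / of_real \<tau> - 1 / 2 = (- q / of_real \<tau>) + 1 / 2" by (simp add: field_simps)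
    then have p: "complex_of_real \<tau> powr (1 - q / of_real \<tau> - 1 / 2) = of_real \<tau> powr (- q / of_real \<tau>) * of_real \<tau> powr (1 / 2)"
      by (simp only: powr_add)
    have "?r \<noteq> 0" "complex_of_real \<tau> powr (1 / 2) \<noteq> 0" using \<tau>0 by auto
    then show ?thesis unfolding A3 a3 B3 b3 p using G nz(9) by (simp add: field_simps)
  qed
  also have "P\<^sup>2 / s * (A1 / a1) * (A2 / a2) * (A4 / a4) * (B1 / b1) * (B2 / b2) * (B4 / b4)
       * (of_real \<tau> powr (- q / of_real \<tau>) * Gamma (1 - q / of_real \<tau>) * (K / k) * (L / k))
    = (P\<^sup>2 / s * of_real \<tau> powr (- q / of_real \<tau>)) * Gamma (1 - q / of_real \<tau>)
       * (A1 / a1) * (A2 / a2) * (K / k) * (A4 / a4) * (L / k) * (B1 / b1) * (B2 / b2) * (B4 / b4)"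
    by (simp add: mult_ac)
  also have "\<dots> = CM_continued \<tau> l1 l2 q"
    unfolding P_def s_def powr_base_identity[OF \<tau>] CM_continued_def A1_def a1_def A2_def a2_def A4_def a4_def
      B1_def b1_def B2_def b2_def B4_def b4_def K_def k_def L_def ..
  finally show ?thesis .
qed

lemma open_admissible_strip: "open (admissible_strip \<tau> l1 l2)"
proof -
  have "admissible_strip \<tau> l1 l2 =
    {q. Re q > max ((1 + \<tau> * (1 + l1 + l2)) / 2) (1 + \<tau> * (1 + l1 + l2))} \<inter>
    {q. Re q < min \<tau> (min (1 + \<tau> * (1 + l1)) (1 + \<tau> * (1 + l2)))}"
    by (auto simp: admissible_strip_def)
  then show ?thesis by (simp only: open_Int open_halfspace_Re_gt open_halfspace_Re_lt)
qed

lemma CM_continued_holomorphic: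
  assumes \<tau>: "\<tau> > 1" and l: "l1 < 0" "l2 < 0" "1 + \<tau> * (1 + l1) > 0" "1 + \<tau> * (1 + l2) > 0"
  shows "CM_continued \<tau> l1 l2 holomorphic_on admissible_strip \<tau> l1 l2"
proof -
  have \<tau>0: "\<tau> > 0" using \<tau> by simp
  note b = strip_bounds[OF \<tau> l(3,4)]
  have G2: "(\<lambda>q. Gamma2 \<tau> (f q)) holomorphic_on admissible_strip \<tau> l1 l2"
    if "f holomorphic_on admissible_strip \<tau> l1 l2" "\<And>q. q \<in> admissible_strip \<tau> l1 l2 \<Longrightarrow> Re (f q) > 0" for f
    using holomorphic_on_compose_gen[OF that(1) Gamma2_holomorphic[OF \<tau>0]] that(2) by (auto simp: o_def)
  have X: "Gamma (1 / \<tau>) * pi * \<tau> powr (1 / \<tau>) / Gamma (1 - 1 / \<tau>) > 0"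
    using \<tau> by (auto intro!: divide_pos_pos mult_pos_pos)
  have G: "(\<lambda>q. Gamma (1 - q / of_real \<tau>)) holomorphic_on admissible_strip \<tau> l1 l2"
  proof (intro holomorphic_intros)
    fix q assume "q \<in> admissible_strip \<tau> l1 l2"
    then show "1 - q / of_real \<tau> \<notin> \<int>\<^sub>\<le>\<^sub>0" using b(1)[of q] \<tau>0 by (intro Re_pos_not_nonpos_Ints) simp
  qed (use \<tau>0 in auto)
  have pos: "Re (1 - q + of_real (\<tau> * (1 + l1))) > 0" "Re (1 - q + of_real (\<tau> * (1 + l2))) > 0"
    "Re (1 - q + of_real \<tau>) > 0" "Re (2 - q + of_real (\<tau> * (2 + l1 + l2))) > 0"
    "Re (2 - 2 * q + of_real (\<tau> * (2 + l1 + l2))) > 0" "Re (q + 1 + of_real \<tau>) > 0"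
    "Re (q - of_real (\<tau> * l1)) > 0" "Re (q - of_real (\<tau> * l2)) > 0"
    "Re (q - 1 - of_real (\<tau> * (1 + l1 + l2))) > 0" "Re (2 * q - 1 - of_real (\<tau> * (1 + l1 + l2))) > 0"
    if "q \<in> admissible_strip \<tau> l1 l2" for q
    using b[OF that] by simp_all
  have const: "Re (1 + of_real (\<tau> * (1 + l1))) > 0" "Re (1 + of_real (\<tau> * (1 + l2))) > 0"
    "Re (1 + of_real \<tau>) > 0" "Re (- of_real (\<tau> * l1)) > 0" "Re (- of_real (\<tau> * l2)) > 0"
    using l \<tau>0 by (simp_all add: mult_pos_neg)
  show ?thesis
    unfolding CM_continued_def of_real_powr_exp[OF X]
    by (intro holomorphic_on_mult holomorphic_on_divide holomorphic_on_exp' G G2 holomorphic_on_const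
        holomorphic_on_ident holomorphic_on_add holomorphic_on_diff pos const Gamma2_nonzero[OF \<tau>0])
qed

text \<open>
  Near a pole of $\Gamma(1+q)$ the two functions agree except at the pole itself, and the
  continued one is continuous there, so it computes the limit.
\<close>

lemma CM_eq_continued:
  assumes \<tau>: "\<tau> > 1" and l: "l1 < 0" "l2 < 0" "1 + \<tau> * (1 + l1) > 0" "1 + \<tau> * (1 + l2) > 0"
    and q: "q \<in> admissible_strip \<tau> l1 l2"
  shows "CM \<tau> l1 l2 q = CM_continued \<tau> l1 l2 q"
proof (cases "1 + q \<in> \<int>\<^sub>\<le>\<^sub>0")
  case False
  then show ?thesis using CM_formula_eq_continued[OF \<tau> l q] by (simp add: CM_def)
next
  case True
  have "\<forall>\<^sub>F z in at q. z \<in> admissible_strip \<tau> l1 l2"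
    by (rule eventually_at_in_open'[OF open_admissible_strip q])
  moreover have "\<forall>\<^sub>F z in at q. 1 + z \<notin> \<int>\<^sub>\<le>\<^sub>0"
  proof -
    have "\<forall>\<^sub>F z in at q. z \<in> ball q 1 - {q}" by (rule eventually_at_in_open) auto
    then show ?thesis
    proof eventually_elim
      case (elim z)
      show ?case
      proof
        assume "1 + z \<in> \<int>\<^sub>\<le>\<^sub>0"
        with True obtain i j where "1 + z = of_int i" "1 + q = of_int j" by (elim nonpos_Ints_cases)
        then have "(1 + z) - (1 + q) = of_int (i - j)" by (simp only: of_int_diff)
        then have "z - q = of_int (i - j)" by simp
        moreover from this have "norm (z - q) = \<bar>real_of_int (i - j)\<bar>" by (simp only: norm_of_int)
        moreover have "norm (z - q) < 1" "z \<noteq> q" using elim by (auto simp: dist_norm norm_minus_commute)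
        ultimately have "i - j \<noteq> 0" "\<bar>real_of_int (i - j)\<bar> < 1" by auto
        then show False by linarith
      qed
    qed
  qed
  ultimately have ev: "\<forall>\<^sub>F z in at q. CM_formula \<tau> l1 l2 z = CM_continued \<tau> l1 l2 z"
    by eventually_elim (rule CM_formula_eq_continued[OF \<tau> l])
  have "CM_continued \<tau> l1 l2 \<midarrow>q\<rightarrow> CM_continued \<tau> l1 l2 q"
    using CM_continued_holomorphic[OF \<tau> l] open_admissible_strip q
    by (meson continuous_on_eq_continuous_at holomorphic_on_imp_continuous_on isContD)
  then have "CM_formula \<tau> l1 l2 \<midarrow>q\<rightarrow> CM_continued \<tau> l1 l2 q"
    using ev by (simp add: tendsto_cong)
  then have "Lim (at q) (CM_formula \<tau> l1 l2) = CM_continued \<tau> l1 l2 q"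
    by (intro tendsto_Lim) auto
  then show ?thesis using True by (simp add: CM_def)
qed

theorem theorem11p1:
  fixes \<tau> l1 l2 :: real
  assumes "\<tau> > 1" and "l1 < 0" and "l2 < 0"
    and "1 + \<tau> * (1 + l1) > 0" and "1 + \<tau> * (1 + l2) > 0"
    and "1 + \<tau> * (l1 + l2) < 0"
  shows
    "(\<forall>n::nat. of_nat n \<in> admissible_strip \<tau> l1 l2 \<longrightarrow>
        CM \<tau> l1 l2 (of_nat n) = complex_of_real (
          1 / fact n
          * (\<Prod>k<n. Gamma (1 - (real k + 1) / \<tau>) * Gamma (1 + l1 - real k / \<tau>)
                       * Gamma (1 + l2 - real k / \<tau>)
                     / (Gamma (1 - 1 / \<tau>)
                        * Gamma (2 + l1 + l2 - (real n + real k - 1) / \<tau>)))\<^sup>2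
          * (\<Prod>k<n. sin (pi * ((real k + 1) / \<tau>)) * sin (pi * (1 + l1 - real k / \<tau>))
                       * sin (pi * (1 + l2 - real k / \<tau>))
                     / (sin (pi / \<tau>)
                        * sin (pi * (2 + l1 + l2 - (real n + real k - 1) / \<tau>))))))
     \<and>
     (\<forall>q \<in> admissible_strip \<tau> l1 l2.
        CM \<tau> l1 l2 q =
          of_real (Gamma (1 / \<tau>) * pi * \<tau> powr (1 / \<tau>) / Gamma (1 - 1 / \<tau>)) powr q
          * Gamma (1 - q / of_real \<tau>)
          * (Gamma2 \<tau> (1 - q + of_real (\<tau> * (1 + l1))) / Gamma2 \<tau> (1 + of_real (\<tau> * (1 + l1))))
          * (Gamma2 \<tau> (1 - q + of_real (\<tau> * (1 + l2))) / Gamma2 \<tau> (1 + of_real (\<tau> * (1 + l2))))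
          * (Gamma2 \<tau> (1 - q + of_real \<tau>) / Gamma2 \<tau> (1 + of_real \<tau>))
          * (Gamma2 \<tau> (2 - q + of_real (\<tau> * (2 + l1 + l2)))
             / Gamma2 \<tau> (2 - 2 * q + of_real (\<tau> * (2 + l1 + l2))))
          * (Gamma2 \<tau> (q + 1 + of_real \<tau>) / Gamma2 \<tau> (1 + of_real \<tau>))
          * (Gamma2 \<tau> (q - of_real (\<tau> * l1)) / Gamma2 \<tau> (- of_real (\<tau> * l1)))
          * (Gamma2 \<tau> (q - of_real (\<tau> * l2)) / Gamma2 \<tau> (- of_real (\<tau> * l2)))
          * (Gamma2 \<tau> (q - 1 - of_real (\<tau> * (1 + l1 + l2)))
             / Gamma2 \<tau> (2 * q - 1 - of_real (\<tau> * (1 + l1 + l2)))))"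
proof (intro conjI allI impI ballI)
  show "CM \<tau> l1 l2 (of_nat n) = complex_of_real (
          1 / fact n
          * (\<Prod>k<n. Gamma (1 - (real k + 1) / \<tau>) * Gamma (1 + l1 - real k / \<tau>)
                       * Gamma (1 + l2 - real k / \<tau>)
                     / (Gamma (1 - 1 / \<tau>)
                        * Gamma (2 + l1 + l2 - (real n + real k - 1) / \<tau>)))\<^sup>2
          * (\<Prod>k<n. sin (pi * ((real k + 1) / \<tau>)) * sin (pi * (1 + l1 - real k / \<tau>))
                       * sin (pi * (1 + l2 - real k / \<tau>))
                     / (sin (pi / \<tau>)
                        * sin (pi * (2 + l1 + l2 - (real n + real k - 1) / \<tau>)))))"
    if "of_nat n \<in> admissible_strip \<tau> l1 l2" for n
    by (rule CM_nat) (use assms that in auto)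
qed (rule CM_eq_continued[unfolded CM_continued_def]; use assms in auto)

end
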